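(* Let $\gamma$ be a regular periodic orbit of the regularized planar two-center problem, lying on a regular torus $\mathbb{T}$ with rotation number $W$; write $W=p/q$ with $p,q$ coprime positive integers. Then the periodic syzygy sequence of $\gamma$ is of the following form, according to the type of $\mathbb{T}$: (L) $1\,3^{n_1}\,2\,3^{n_2}\,1\,3^{n_3}\,2\cdots 3^{n_s}$ (the symbols 1 and 2 alternate, separated by blocks of 3's); (S) $1\,3^{n_1}\,1\,3^{n_2}\,1\,3^{n_3}\,1\cdots 3^{n_s}$ or $2\,3^{n_1}\,2\,3^{n_2}\,2\,3^{n_3}\cdots 2\,3^{n_s}$; (P) $(12)^q$; where in cases L and S the exponents $n_i$ are those of the Sturmian word of the rational number $W$. In the cases L and S the length of the syzygy word recorded over one period of $\gamma$ on $\mathbb{T}$ is $2(p+q)$.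
   Context: Fix $d>0$ and masses $m_1,m_2>0$ at the points $(-d,0)$ and $(d,0)$ of the plane. A test particle moves with Hamiltonian $H=\tfrac12(p_x^2+p_y^2)-m_1/\sqrt{(x+d)^2+y^2}-m_2/\sqrt{(x-d)^2+y^2}$; only energies $h<0$ are considered. Regularization: introduce $(\lambda,\nu)\in\mathbb{R}\times(\mathbb{R}/2\pi\mathbb{Z})$ by $x+iy=d\sin(\nu+i\lambda)$, i.e. $(x,y)=(d\cosh\lambda\sin\nu,\ d\sinh\lambda\cos\nu)$ (a double cover of the plane branched over the two centers, which correspond to $(\lambda,\nu)=(0,\pm\pi/2)$), with conjugate momenta $p_\lambda,p_\nu$, and the time change $dt=d^2(\cosh^2\lambda-\sin^2\nu)\,d\tau$. On the energy level $H=h$ the motion becomes (in time $\tau$) the flow of $H_\lambda(\lambda,p_\lambda)+H_\nu(\nu,p_\nu)$ on its zero level, where $H_\lambda=\tfrac12p_\lambda^2-d(m_1+m_2)\cosh\lambda-hd^2\cosh^2\lambda$ and $H_\nu=\tfrac12p_\nu^2+d(m_1-m_2)\sin\nu+hd^2\sin^2\nu$; each orbit lies in a set $\{H_\lambda=-g,\ H_\nu=g\}$, $g$ being a separation constant (the value of Euler's second integral). Regular torus: a compact connected component $\mathbb{T}=C_\lambda\times C_\nu$ of such a set, where $-g$ is a regular value of $H_\lambda$ and $g$ a regular value of $H_\nu$; here $C_\lambda$ is a closed curve in the $(\lambda,p_\lambda)$-plane and $C_\nu$ a closed curve in the cylinder $(\nu,p_\nu)\in(\mathbb{R}/2\pi\mathbb{Z})\times\mathbb{R}$.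 Every regular torus is of one of three types: S (satellite) if $C_\nu$ is contractible in the cylinder; L (lemniscate) if $C_\nu$ winds around the cylinder and $C_\lambda$ meets $\{\lambda=0\}$; P (planetary) if $C_\nu$ winds around the cylinder and $C_\lambda$ does not meet $\{\lambda=0\}$. Rotation number: if $T_\lambda,T_\nu$ are the $\tau$-periods of the one-degree-of-freedom motions on $C_\lambda$ and $C_\nu$, then $W=T_\nu/T_\lambda>0$. With angles $\theta_1\in\mathbb{R}/\mathbb{Z}$ along $C_\nu$ and $\theta_2\in\mathbb{R}/\mathbb{Z}$ along $C_\lambda$, each increasing uniformly in $\tau$ with period 1, the flow on $\mathbb{T}$ is linear with lifts $\theta_2=W\theta_1+\mathrm{const}$. Syzygies: the particle is on the $x$-axis iff $\lambda=0$ or $\nu\equiv\pm\pi/2$. Record symbol 3 when $\lambda=0$, $\nu\not\equiv\pm\pi/2$ (particle strictly between the centers), symbol 1 when $\nu\equiv-\pi/2$, $\lambda\neq0$ (particle on $x<-d$), symbol 2 when $\nu\equiv\pi/2$, $\lambda\ne0$ (particle on $x>d$). Collision points are those with $\lambda=0$, $\nu\equiv\pm\pi/2$. A regular periodic orbit is a periodic orbit of the regularized flow on a regular torus that contains no collision point; its periodic syzygy sequence is the cyclic word of symbols recorded in time order over one period. Sturmian word: for $m>0$ and $y_0$ with the line $y=mx+y_0$ avoiding $\mathbb{Z}^2$, put $y_k=y_0+km$ and $n_k=\lfloor m\rfloor$ if $\{y_{k-1}\}+\{m\}<1$, $n_k=\lfloor m\rfloor+1$ if $\{y_{k-1}\}+\{m\}>1$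 ($\lfloor\cdot\rfloor$ floor, $\{\cdot\}$ fractional part). For rational $m$ the resulting periodic sequence $(n_k)$, up to index shift, does not depend on $y_0$; it is the Sturmian word of $m$. *)

theory Defs
  imports "HOL-Analysis.Analysis"
begin

text \<open>Separated regularized Hamiltonians of the planar two-center problem.
  Arguments: d m1 m2 h, then the canonical pair.\<close>

definition Hlam :: "real \<Rightarrow> real \<Rightarrow> real \<Rightarrow> real \<Rightarrow> real \<times> real \<Rightarrow> real" where
  "Hlam d m1 m2 h = (\<lambda>(l, p). p\<^sup>2 / 2 - d * (m1 + m2) * cosh l - h * d\<^sup>2 * (cosh l)\<^sup>2)"

definition Hnu :: "real \<Rightarrow> real \<Rightarrow> real \<Rightarrow> real \<Rightarrow> real \<times> real \<Rightarrow> real" where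
  "Hnu d m1 m2 h = (\<lambda>(v, p). p\<^sup>2 / 2 + d * (m1 - m2) * sin v + h * d\<^sup>2 * (sin v)\<^sup>2)"

text \<open>The cylinder (R/2piZ) x R, embedded in R^3 as S^1 x R via nu |-> (cos nu, sin nu).\<close>

definition cyl_of :: "real \<times> real \<Rightarrow> real \<times> real \<times> real" where
  "cyl_of = (\<lambda>(v, p). (cos v, sin v, p))"

definition cylinder :: "(real \<times> real \<times> real) set" where
  "cylinder = range cyl_of"

definition regular_value :: "('a::real_normed_vector \<Rightarrow> real) \<Rightarrow> real \<Rightarrow> bool" where
  "regular_value f c \<longleftrightarrow>
     (\<forall>x. f x = c \<longrightarrow> (\<exists>D. (f has_derivative D) (at x) \<and> D \<noteq> (\<lambda>_. 0)))"

definition min_period :: "(real \<Rightarrow> 'a) \<Rightarrow> real \<Rightarrow> bool" where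
  "min_period f T \<longleftrightarrow> T > 0 \<and> (\<forall>t. f (t + T) = f t) \<and>
     (\<forall>T'. 0 < T' \<and> T' < T \<longrightarrow> \<not> (\<forall>t. f (t + T') = f t))"

text \<open>Regularized flow (time tau) of H_lambda + H_nu, written out as Hamilton's equations,
  with nu lifted to R.\<close>

definition reg_solution ::
  "real \<Rightarrow> real \<Rightarrow> real \<Rightarrow> real \<Rightarrow> (real \<Rightarrow> real) \<Rightarrow> (real \<Rightarrow> real) \<Rightarrow> (real \<Rightarrow> real) \<Rightarrow> (real \<Rightarrow> real) \<Rightarrow> bool"
  where
  "reg_solution d m1 m2 h lam plam nu pnu \<longleftrightarrow>
     (\<forall>t. (lam has_real_derivative plam t) (at t) \<and>
          (plam has_real_derivative
              (d * (m1 + m2) * sinh (lam t) + 2 * h * d\<^sup>2 * cosh (lam t) * sinh (lam t))) (at t) \<and>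
          (nu has_real_derivative pnu t) (at t) \<and>
          (pnu has_real_derivative
              - (d * (m1 - m2) * cos (nu t) + 2 * h * d\<^sup>2 * sin (nu t) * cos (nu t))) (at t))"

definition syzygy_times :: "(real \<Rightarrow> real) \<Rightarrow> (real \<Rightarrow> real) \<Rightarrow> real \<Rightarrow> real set" where
  "syzygy_times lam nu T = {t \<in> {0..<T}. lam t = 0 \<or> sin (nu t) = 1 \<or> sin (nu t) = -1}"

definition syzygy_symbol :: "(real \<Rightarrow> real) \<Rightarrow> (real \<Rightarrow> real) \<Rightarrow> real \<Rightarrow> nat" where
  "syzygy_symbol lam nu t = (if lam t = 0 then 3 else if sin (nu t) = -1 then 1 else 2)"

definition syzygy_word :: "(real \<Rightarrow> real) \<Rightarrow> (real \<Rightarrow> real) \<Rightarrow> real \<Rightarrow> nat list" where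
  "syzygy_word lam nu T = map (syzygy_symbol lam nu) (sorted_list_of_set (syzygy_times lam nu T))"

text \<open>Sturmian sequence: the line y = m x + y0 avoids Z^2, and n_k for k >= 1.\<close>

definition line_avoids_lattice :: "real \<Rightarrow> real \<Rightarrow> bool" where
  "line_avoids_lattice m y0 \<longleftrightarrow> (\<forall>a b :: int. real_of_int b \<noteq> m * real_of_int a + y0)"

definition sturm :: "real \<Rightarrow> real \<Rightarrow> nat \<Rightarrow> nat" where
  "sturm m y0 k =
     (if frac (y0 + (real k - 1) * m) + frac m < 1 then nat \<lfloor>m\<rfloor> else nat \<lfloor>m\<rfloor> + 1)"

definition block :: "nat \<Rightarrow> nat \<Rightarrow> nat list" where
  "block c n = c # replicate n 3"

definition word_L :: "(nat \<Rightarrow> nat) \<Rightarrow> nat \<Rightarrow> nat list" where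
  "word_L n s = concat (map (\<lambda>i. block (if odd i then 1 else 2) (n i)) [1..<s+1])"

definition word_S :: "nat \<Rightarrow> (nat \<Rightarrow> nat) \<Rightarrow> nat \<Rightarrow> nat list" where
  "word_S c n s = concat (map (\<lambda>i. block c (n i)) [1..<s+1])"

definition word_P :: "nat \<Rightarrow> nat list" where
  "word_P q = concat (replicate q [1, 2])"

end

theory Submission
  imports Defs
begin

text \<open>
  Both one-degree-of-freedom systems are symmetric under reflection at the axis crossings
  (\<open>\<lambda> = 0\<close>, respectively \<open>\<nu> \<equiv> \<plusminus>\<pi>/2\<close>). Uniqueness of solutions makes the motion odd about every
  crossing time, so half a period after a crossing there is another one; as there are only two
  states in which a crossing can occur, the crossing times form an arithmetic progression whose
  step is half the period. A syzygy word thus interleaves two progressions with steps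
  \<open>T\<^sub>\<nu>/2\<close> and \<open>T\<^sub>\<lambda>/2\<close>, and the number of 3's between consecutive crossings of \<open>\<nu> \<equiv> \<plusminus>\<pi>/2\<close>
  is a difference of floors along a line of slope \<open>W\<close>, that is, a Sturmian exponent.

  The curve \<open>C\<^sub>\<nu>\<close> is contractible exactly if \<open>g\<close> lies below the maximum of the potential in \<open>\<nu>\<close>:
  below it, \<open>C\<^sub>\<nu>\<close> misses a vertical line of the cylinder, and above it, \<open>C\<^sub>\<nu>\<close> contains the graph of a
  function over the circle.
\<close>

section \<open>Newton's equation in one degree of freedom\<close>

text \<open>Both separated systems have this form, with \<open>nu\<close> lifted to the real line,
  so that one uniqueness theorem serves both.\<close>

definition newton :: "(real \<Rightarrow> real) \<Rightarrow> (real \<Rightarrow> real) \<Rightarrow> (real \<Rightarrow> real) \<Rightarrow> bool" where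
  "newton f x p \<longleftrightarrow>
     (\<forall>t. (x has_real_derivative p t) (at t) \<and> (p has_real_derivative f (x t)) (at t))"

lemma newton_shift:
  assumes "newton f x p"
  shows "newton f (\<lambda>t. x (s + t)) (\<lambda>t. p (s + t))"
  using assms unfolding newton_def by (auto simp: DERIV_shift[symmetric] add.commute)

lemma newton_reverse:
  assumes "newton f x p"
  shows "newton f (\<lambda>t. x (s - t)) (\<lambda>t. - p (s - t))"
  unfolding newton_def
proof (intro allI conjI)
  fix t
  have d: "((\<lambda>t. s - t) has_real_derivative - 1) (at t)"
    by (auto intro!: derivative_eq_intros)
  have "(x has_real_derivative p (s - t)) (at (s - t))"
    and "(p has_real_derivative f (x (s - t))) (at (s - t))"
    using assms by (auto simp: newton_def)
  from DERIV_chain2[OF this(1) d] DERIV_minus[OF DERIV_chain2[OF this(2) d]]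
  show "((\<lambda>t. x (s - t)) has_real_derivative - p (s - t)) (at t)"
    and "((\<lambda>t. - p (s - t)) has_real_derivative f (x (s - t))) (at t)" by auto
qed

lemma newton_reflect:
  assumes "newton f x p" and "\<And>u. f (c - u) = - f u"
  shows "newton f (\<lambda>t. c - x t) (\<lambda>t. - p t)"
  using assms unfolding newton_def by (auto intro!: derivative_eq_intros)

lemma newton_translate:
  assumes "newton f x p" and "\<And>u. f (u + c) = f u"
  shows "newton f (\<lambda>t. x t + c) p"
  using assms unfolding newton_def by (auto intro!: derivative_eq_intros)

text \<open>Gronwall's argument: \<open>f\<close> is Lipschitz on the bounded range of both
  trajectories over \<open>{t0..t1}\<close>, so the squared phase distance \<open>E\<close> obeys
  \<open>E' <= (1 + K) * E\<close>, and \<open>E\<close> damped by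
  \<open>exp (- (1 + K) * t)\<close> cannot grow from its initial value 0.\<close>

lemma newton_unique_forward:
  fixes f f' :: "real \<Rightarrow> real"
  assumes f: "\<And>u. (f has_real_derivative f' u) (at u)" and f': "continuous_on UNIV f'"
    and x: "newton f x p" and y: "newton f y r"
    and init: "x t0 = y t0" "p t0 = r t0" and t: "t0 \<le> t1"
  shows "x t1 = y t1 \<and> p t1 = r t1"
proof -
  have cont: "continuous_on {t0..t1} x" "continuous_on {t0..t1} y"
    using x y unfolding newton_def by (meson DERIV_isCont continuous_at_imp_continuous_on)+
  obtain R where R: "\<forall>s\<in>{t0..t1}. \<bar>x s\<bar> \<le> R \<and> \<bar>y s\<bar> \<le> R"
  proof -
    have "bounded (x ` {t0..t1})" "bounded (y ` {t0..t1})"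
      using cont by (auto intro!: compact_imp_bounded compact_continuous_image)
    then obtain R1 R2 where "\<forall>s\<in>{t0..t1}. \<bar>x s\<bar> \<le> R1" "\<forall>s\<in>{t0..t1}. \<bar>y s\<bar> \<le> R2"
      by (auto simp: bounded_iff)
    then show ?thesis by (intro that[of "max R1 R2"]) fastforce
  qed
  have "bounded (f' ` {-R..R})"
    using f' by (meson compact_Icc compact_continuous_image compact_imp_bounded
        continuous_on_subset subset_UNIV)
  then obtain K where K: "\<forall>u\<in>{-R..R}. \<bar>f' u\<bar> \<le> K" by (auto simp: bounded_iff)
  have lip: "\<bar>f u - f v\<bar> \<le> K * \<bar>u - v\<bar>" if "u \<in> {-R..R}" "v \<in> {-R..R}" for u v
    using field_differentiable_bound[of "{-R..R}" f f' K u v] K that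
      has_field_derivative_at_within[OF f]
    by auto
  define E where "E = (\<lambda>s. (x s - y s)\<^sup>2 + (p s - r s)\<^sup>2)"
  define E' where "E' = (\<lambda>s. 2 * (x s - y s) * (p s - r s) + 2 * ((p s - r s) * (f (x s) - f (y s))))"
  have dE: "(E has_real_derivative E' s) (at s)" for s
  proof -
    note [derivative_intros] = x[unfolded newton_def, rule_format, of s, THEN conjunct1]
      x[unfolded newton_def, rule_format, of s, THEN conjunct2]
      y[unfolded newton_def, rule_format, of s, THEN conjunct1]
      y[unfolded newton_def, rule_format, of s, THEN conjunct2]
    show ?thesis unfolding E_def E'_def
      by (rule derivative_eq_intros refl | simp add: algebra_simps)+
  qed
  have bd: "E' s \<le> (1 + K) * E s" if "s \<in> {t0..t1}" for s
  proof -
    have xy: "x s \<in> {-R..R}" "y s \<in> {-R..R}" using bspec[OF R that] by auto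
    have "K \<ge> 0" using K xy by fastforce
    have "2 * ((p s - r s) * (f (x s) - f (y s))) \<le> 2 * (\<bar>p s - r s\<bar> * \<bar>f (x s) - f (y s)\<bar>)"
      using abs_ge_self[of "(p s - r s) * (f (x s) - f (y s))"] by (simp only: abs_mult)
    also have "\<dots> \<le> 2 * (\<bar>p s - r s\<bar> * (K * \<bar>x s - y s\<bar>))"
      using lip[OF xy] by (intro mult_left_mono) auto
    also have "\<dots> = K * (2 * \<bar>x s - y s\<bar> * \<bar>p s - r s\<bar>)" by simp
    also have "\<dots> \<le> K * E s"
      using \<open>K \<ge> 0\<close> sum_squares_bound[of "\<bar>x s - y s\<bar>" "\<bar>p s - r s\<bar>"]
      by (intro mult_left_mono) (auto simp: E_def)
    finally have "E' s \<le> E s + K * E s"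
      using sum_squares_bound[of "x s - y s" "p s - r s"]
      unfolding E'_def by (intro add_mono) (auto simp: E_def)
    then show ?thesis by (simp add: distrib_right)
  qed
  have "E t1 * exp (- (1 + K) * t1) \<le> E t0 * exp (- (1 + K) * t0)"
  proof (rule DERIV_nonpos_imp_nonincreasing[OF t])
    fix s assume s: "t0 \<le> s" "s \<le> t1"
    have "((\<lambda>s. exp (- (1 + K) * s)) has_real_derivative - (1 + K) * exp (- (1 + K) * s)) (at s)"
      by (auto intro!: derivative_eq_intros)
    from DERIV_mult[OF dE this]
    have "((\<lambda>s. E s * exp (- (1 + K) * s)) has_real_derivative
            (E' s - (1 + K) * E s) * exp (- (1 + K) * s)) (at s)"
      by (rule DERIV_cong) (simp add: algebra_simps)
    moreover have "(E' s - (1 + K) * E s) * exp (- (1 + K) * s) \<le> 0"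
      using bd[of s] s by (intro mult_nonpos_nonneg) auto
    ultimately show "\<exists>y. ((\<lambda>s. E s * exp (- (1 + K) * s)) has_real_derivative y) (at s) \<and> y \<le> 0"
      by blast
  qed
  moreover have "E t0 = 0" using init by (simp add: E_def)
  ultimately have "E t1 \<le> 0" by (simp add: mult_le_0_iff)
  then show ?thesis
    by (auto simp: E_def sum_power2_le_zero_iff)
qed

lemma newton_unique:
  fixes f f' :: "real \<Rightarrow> real"
  assumes f: "\<And>u. (f has_real_derivative f' u) (at u)" and f': "continuous_on UNIV f'"
    and x: "newton f x p" and y: "newton f y r"
    and init: "x t0 = y t0" "p t0 = r t0"
  shows "x t = y t \<and> p t = r t"
proof (cases "t0 \<le> t")
  case True
  then show ?thesis using newton_unique_forward[OF f f' x y init] by simp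
next
  case False
  \<comment> \<open>Reversal about \<open>t0\<close> fixes the initial time and turns the past into
    the future.\<close>
  then show ?thesis
    using newton_unique_forward[OF f f' newton_reverse[OF x, of "2 * t0"]
        newton_reverse[OF y, of "2 * t0"], of t0 "2 * t0 - t"] init
    by simp
qed

section \<open>Minimal periods\<close>

lemma min_period_int:
  assumes "min_period f T"
  shows "f (t + of_int k * T) = f t"
proof -
  have per: "f (t + T) = f t" for t using assms by (simp add: min_period_def)
  have nat: "f (t + of_nat n * T) = f t" for n t
  proof (induction n)
    case (Suc n)
    then show ?case using per[of "t + of_nat n * T"] by (simp add: algebra_simps)
  qed simp
  show ?thesis
  proof (cases "k \<ge> 0")
    case True
    then show ?thesis using nat[of t "nat k"] by simp
  next
    case False
    then show ?thesis using nat[of "t + of_int k * T" "nat (- k)"] by simp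
  qed
qed

text \<open>The remainder of \<open>S\<close> modulo \<open>T\<close> is again a period and less
  than \<open>T\<close>, so minimality makes it 0.\<close>

lemma min_period_multiple:
  assumes mp: "min_period f T" and S: "\<And>t. f (t + S) = f t"
  obtains k :: int where "S = of_int k * T"
proof -
  have T: "T > 0" using mp by (simp add: min_period_def)
  define r where "r = S - of_int \<lfloor>S / T\<rfloor> * T"
  have "f (t + r) = f t" for t
    using min_period_int[OF mp, of "t + r" "\<lfloor>S / T\<rfloor>"] S[of t] by (simp add: r_def)
  moreover have "r \<ge> 0" "r < T"
    using floor_divide_lower[OF T, of S] floor_divide_upper[OF T, of S]
    by (simp_all add: r_def distrib_right)
  ultimately have "r = 0" using mp unfolding min_period_def by (metis less_eq_real_def)
  then show ?thesis by (intro that[of "\<lfloor>S / T\<rfloor>"]) (simp add: r_def)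
qed

text \<open>A common period is both \<open>a * Tg\<close> and \<open>b * Tf\<close>. Since
  \<open>q * Tg = p * Tf\<close> is a common period, \<open>a <= q\<close>; comparing the two
  expressions for \<open>T\<close>, coprimality gives that \<open>q\<close> divides
  \<open>a\<close>.\<close>

lemma min_period_Pair:
  assumes F: "min_period (\<lambda>t. (f t, g t)) T"
    and f: "min_period f Tf" and g: "min_period g Tg"
    and pq: "p > 0" "q > 0" "coprime p q" and W: "Tg / Tf = real p / real q"
  shows "T = real q * Tg" "T = real p * Tf"
proof -
  have pos: "T > 0" "Tf > 0" "Tg > 0" using F f g by (auto simp: min_period_def)
  have "f (t + T) = f t" "g (t + T) = g t" for t using F by (auto simp: min_period_def)
  then obtain a b :: int where a: "T = of_int a * Tg" and b: "T = of_int b * Tf"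
    using min_period_multiple[OF f] min_period_multiple[OF g] by metis
  have eq: "real q * Tg = real p * Tf" using W pos pq by (simp add: field_simps)
  have "f (t + real q * Tg) = f t" "g (t + real q * Tg) = g t" for t
    using min_period_int[OF f, of t "int p"] min_period_int[OF g, of t "int q"] eq by auto
  then have "T \<le> real q * Tg"
    using F pos pq unfolding min_period_def by (metis not_le mult_pos_pos of_nat_0_less_iff)
  then have "a \<le> int q" using pos a by simp
  have "a > 0" using a pos by (simp add: zero_less_mult_iff)
  have "of_int a * (real p * Tf) = of_int a * (real q * Tg)" using eq by simp
  also have "\<dots> = real q * (of_int a * Tg)" by simp
  also have "\<dots> = of_int b * Tf * real q" using a b by simp
  finally have "of_int a * (real p * Tf) = of_int b * Tf * real q" .
  then have "of_int a * real p = of_int b * real q" using pos by simp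
  then have "of_int (a * int p) = (of_int (b * int q) :: real)" by simp
  then have "a * int p = b * int q" by (simp only: of_int_eq_iff)
  then have "int q dvd a * int p" by simp
  then have "int q dvd a" using pq by (simp add: coprime_dvd_mult_left_iff coprime_commute)
  then have "a = int q" using \<open>a \<le> int q\<close> \<open>a > 0\<close> by (simp add: zdvd_imp_le order_antisym)
  then show "T = real q * Tg" "T = real p * Tf" using a eq by auto
qed

text \<open>By \<open>det\<close> a state recurs only after multiples of \<open>P\<close>. As
  \<open>P / 2\<close> is not a period, the crossing at \<open>t0 + P / 2\<close> is in the second
  state \<open>A\<close>; the crossings in the two states form progressions of step
  \<open>P\<close>, which interleave to one of step \<open>P / 2\<close>.\<close>

lemma half_period_crossings:
  fixes \<phi> :: "real \<Rightarrow> 'a"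
  assumes per: "min_period \<phi> P"
    and det: "\<And>s t r. \<phi> s = \<phi> t \<Longrightarrow> \<phi> (s + r) = \<phi> (t + r)"
    and Z: "Z (\<phi> t0)" "Z (\<phi> (t0 + P / 2))"
    and two: "\<And>t. Z (\<phi> t) \<Longrightarrow> \<phi> t = \<phi> t0 \<or> \<phi> t = A"
  shows "{t. Z (\<phi> t)} = range (\<lambda>k::int. t0 + of_int k * (P / 2))"
    and "\<phi> (t0 + P / 2) \<noteq> \<phi> t0"
proof -
  have P: "P > 0" using per by (simp add: min_period_def)
  show neq: "\<phi> (t0 + P / 2) \<noteq> \<phi> t0"
  proof
    assume eq: "\<phi> (t0 + P / 2) = \<phi> t0"
    have "\<phi> (t + P / 2) = \<phi> t" for t
      using det[OF eq, of "t - t0"] by (simp add: algebra_simps)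
    moreover have "0 < P / 2" "P / 2 < P" using P by auto
    ultimately show False using per unfolding min_period_def by blast
  qed
  then have A: "\<phi> (t0 + P / 2) = A" using two Z by blast
  have mult: "\<exists>k::int. t - s = of_int k * P" if eq: "\<phi> t = \<phi> s" for s t
  proof -
    have "\<phi> (r + (t - s)) = \<phi> r" for r using det[OF eq, of "r - s"] by (simp add: algebra_simps)
    then show ?thesis using min_period_multiple[OF per] by metis
  qed
  show "{t. Z (\<phi> t)} = range (\<lambda>k::int. t0 + of_int k * (P / 2))"
  proof (intro equalityI subsetI)
    fix t assume "t \<in> {t. Z (\<phi> t)}"
    then consider "\<phi> t = \<phi> t0" | "\<phi> t = \<phi> (t0 + P / 2)" using two A by auto
    then show "t \<in> range (\<lambda>k::int. t0 + of_int k * (P / 2))"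
    proof cases
      case 1
      then obtain k :: int where "t - t0 = of_int k * P" using mult by blast
      then have "t = t0 + of_int (2 * k) * (P / 2)" by (simp add: algebra_simps)
      then show ?thesis by blast
    next
      case 2
      then obtain k :: int where "t - (t0 + P / 2) = of_int k * P" using mult by blast
      then have "t = t0 + of_int (2 * k + 1) * (P / 2)" by (simp add: field_simps)
      then show ?thesis by blast
    qed
  next
    fix t assume "t \<in> range (\<lambda>k::int. t0 + of_int k * (P / 2))"
    then obtain k :: int where k: "t = t0 + of_int k * (P / 2)" by blast
    show "t \<in> {t. Z (\<phi> t)}"
    proof (cases "even k")
      case True
      then obtain j where "k = 2 * j" by blast
      then have "t = t0 + of_int j * P" using k by simp
      then show ?thesis using min_period_int[OF per] Z by simp
    next
      case False
      then obtain j where "k = 2 * j + 1" by (blast elim: oddE)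
      then have "t = (t0 + P / 2) + of_int j * P" using k by (simp add: field_simps)
      then show ?thesis using min_period_int[OF per, of "t0 + P / 2"] Z by simp
    qed
  qed
qed

section \<open>Words of interleaved arithmetic progressions\<close>

lemma sorted_list_of_set_Un_less:
  fixes A B :: "'a::linorder set"
  assumes "finite A" "finite B" and less: "\<And>a b. a \<in> A \<Longrightarrow> b \<in> B \<Longrightarrow> a < b"
  shows "sorted_list_of_set (A \<union> B) = sorted_list_of_set A @ sorted_list_of_set B"
proof (rule sorted_distinct_set_unique)
  have "A \<inter> B = {}" using less by fastforce
  then show "distinct (sorted_list_of_set A @ sorted_list_of_set B)"
    using assms(1,2) by simp
  show "sorted (sorted_list_of_set A @ sorted_list_of_set B)"
    using assms by (auto simp: sorted_append intro: less_imp_le)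
qed (use assms in auto)

lemma sorted_list_of_set_translate:
  fixes A :: "real set"
  assumes "finite A"
  shows "sorted_list_of_set ((\<lambda>t. t + T) ` A) = map (\<lambda>t. t + T) (sorted_list_of_set A)"
proof (rule sorted_distinct_set_unique)
  show "sorted (map (\<lambda>t. t + T) (sorted_list_of_set A))"
    using sorted_sorted_list_of_set[of A] by (simp add: sorted_wrt_map)
  show "distinct (map (\<lambda>t. t + T) (sorted_list_of_set A))"
    by (simp add: distinct_map inj_on_def)
qed (use assms in auto)

text \<open>Moving the window from 0 to \<open>a\<close> only carries the times before
  \<open>a\<close> to the end, translated by the period; this lets a word be read from a crossing
  onwards.\<close>

lemma periodic_word_rotate:
  fixes S :: "real set" and \<sigma> :: "real \<Rightarrow> 'b"
  assumes fin: "\<And>u v. finite (S \<inter> {u..<v})"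
    and S: "\<And>t. t + T \<in> S \<longleftrightarrow> t \<in> S" and \<sigma>: "\<And>t. \<sigma> (t + T) = \<sigma> t"
    and a: "0 \<le> a" "a < T"
  shows "\<exists>k. map \<sigma> (sorted_list_of_set (S \<inter> {0..<T}))
           = rotate k (map \<sigma> (sorted_list_of_set (S \<inter> {a..<a + T})))"
proof -
  let ?X = "sorted_list_of_set (S \<inter> {0..<a})" and ?Y = "sorted_list_of_set (S \<inter> {a..<T})"
  have X: "S \<inter> {0..<T} = (S \<inter> {0..<a}) \<union> (S \<inter> {a..<T})" using a by auto
  have 1: "sorted_list_of_set (S \<inter> {0..<T}) = ?X @ ?Y"
    unfolding X by (rule sorted_list_of_set_Un_less) (use fin in auto)
  have "S \<inter> {T..<a + T} = (\<lambda>t. t + T) ` (S \<inter> {0..<a})"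
  proof (intro equalityI subsetI)
    fix t assume "t \<in> S \<inter> {T..<a + T}"
    then have "t - T \<in> S \<inter> {0..<a}" using S[of "t - T"] by auto
    then show "t \<in> (\<lambda>t. t + T) ` (S \<inter> {0..<a})" by force
  qed (use S in auto)
  then have 2: "sorted_list_of_set (S \<inter> {T..<a + T}) = map (\<lambda>t. t + T) ?X"
    using sorted_list_of_set_translate[OF fin] by simp
  have Y: "S \<inter> {a..<a + T} = (S \<inter> {a..<T}) \<union> (S \<inter> {T..<a + T})" using a by auto
  have 3: "sorted_list_of_set (S \<inter> {a..<a + T}) = ?Y @ map (\<lambda>t. t + T) ?X"
    unfolding Y 2[symmetric] by (rule sorted_list_of_set_Un_less) (use fin in auto)
  have "map \<sigma> (map (\<lambda>t. t + T) ?X) = map \<sigma> ?X" by (simp add: \<sigma>)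
  then have "map \<sigma> (sorted_list_of_set (S \<inter> {0..<T}))
      = rotate (length (map \<sigma> ?Y)) (map \<sigma> (sorted_list_of_set (S \<inter> {a..<a + T})))"
    unfolding 1 3 map_append rotate_append by simp
  then show ?thesis by blast
qed

lemma sorted_list_of_set_blocks:
  fixes S :: "real set"
  assumes "\<delta> > 0" and fin: "\<And>u v. finite (S \<inter> {u..<v})"
  shows "sorted_list_of_set (S \<inter> {a..<a + real n * \<delta>}) =
    concat (map (\<lambda>i. sorted_list_of_set (S \<inter> {a + (real i - 1) * \<delta>..<a + real i * \<delta>})) [1..<n+1])"
proof (induction n)
  case (Suc n)
  have "S \<inter> {a..<a + real (Suc n) * \<delta>} = (S \<inter> {a..<a + real n * \<delta>}) \<union>
      (S \<inter> {a + (real (Suc n) - 1) * \<delta>..<a + real (Suc n) * \<delta>})" (is "_ = ?A \<union> ?B")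
  proof -
    define w where "w = a + real n * \<delta>"
    have "a \<le> w" and e: "a + real (Suc n) * \<delta> = w + \<delta>" "a + (real (Suc n) - 1) * \<delta> = w"
      using \<open>\<delta> > 0\<close> by (simp_all add: w_def algebra_simps)
    then show ?thesis unfolding e w_def[symmetric] using \<open>\<delta> > 0\<close> by auto
  qed
  moreover have "sorted_list_of_set (?A \<union> ?B) = sorted_list_of_set ?A @ sorted_list_of_set ?B"
    by (rule sorted_list_of_set_Un_less) (use fin in auto)
  ultimately show ?case using Suc by simp
qed simp

section \<open>Counting points of a progression in an interval, and Sturmian exponents as floor
  differences\<close>

lemma arithmetic_progression_Int:
  fixes b \<epsilon> u v :: real
  assumes \<epsilon>: "\<epsilon> > 0" and v: "v \<notin> range (\<lambda>k::int. b + of_int k * \<epsilon>)"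
  shows "range (\<lambda>k::int. b + of_int k * \<epsilon>) \<inter> {u<..<v}
           = (\<lambda>k::int. b + of_int k * \<epsilon>) ` {\<lfloor>(u - b) / \<epsilon>\<rfloor> <.. \<lfloor>(v - b) / \<epsilon>\<rfloor>}"
proof -
  have "u < b + of_int k * \<epsilon> \<longleftrightarrow> \<lfloor>(u - b) / \<epsilon>\<rfloor> < k" for k :: int
    using \<epsilon> by (simp add: floor_less_iff divide_less_eq algebra_simps)
  moreover have "b + of_int k * \<epsilon> < v \<longleftrightarrow> k \<le> \<lfloor>(v - b) / \<epsilon>\<rfloor>" for k :: int
  proof -
    \<comment> \<open>Off the progression the strict bound at \<open>v\<close> is the same as the
      weak one, which is what the floor expresses.\<close>
    have "b + of_int k * \<epsilon> \<noteq> v" using v by auto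
    then have "b + of_int k * \<epsilon> < v \<longleftrightarrow> of_int k * \<epsilon> \<le> v - b" by auto
    then show ?thesis using \<epsilon> by (simp add: le_floor_iff pos_le_divide_eq)
  qed
  ultimately show ?thesis by (auto simp: image_iff)
qed

lemma card_arithmetic_progression_Int:
  fixes b \<epsilon> u v :: real
  assumes "\<epsilon> > 0" and "v \<notin> range (\<lambda>k::int. b + of_int k * \<epsilon>)"
  shows "card (range (\<lambda>k::int. b + of_int k * \<epsilon>) \<inter> {u<..<v})
           = nat (\<lfloor>(v - b) / \<epsilon>\<rfloor> - \<lfloor>(u - b) / \<epsilon>\<rfloor>)"
  unfolding arithmetic_progression_Int[OF assms]
  using assms(1) by (subst card_image) (auto simp: inj_on_def)

lemma finite_arithmetic_progression_Int:
  fixes b \<epsilon> u v :: real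
  assumes \<epsilon>: "\<epsilon> > 0"
  shows "finite (range (\<lambda>k::int. b + of_int k * \<epsilon>) \<inter> {u..<v})"
proof (rule finite_subset)
  show "range (\<lambda>k::int. b + of_int k * \<epsilon>) \<inter> {u..<v}
      \<subseteq> (\<lambda>k::int. b + of_int k * \<epsilon>) ` {\<lfloor>(u - b) / \<epsilon>\<rfloor> .. \<lceil>(v - b) / \<epsilon>\<rceil>}"
  proof
    fix t assume "t \<in> range (\<lambda>k::int. b + of_int k * \<epsilon>) \<inter> {u..<v}"
    then obtain k :: int where k: "t = b + of_int k * \<epsilon>" "u \<le> t" "t < v" by auto
    then have "(u - b) / \<epsilon> \<le> of_int k" "of_int k \<le> (v - b) / \<epsilon>"
      using \<epsilon> by (auto simp: field_simps)
    then have "k \<in> {\<lfloor>(u - b) / \<epsilon>\<rfloor> .. \<lceil>(v - b) / \<epsilon>\<rceil>}" by (simp add: floor_le_iff le_ceiling_iff)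
    then show "t \<in> (\<lambda>k::int. b + of_int k * \<epsilon>) ` {\<lfloor>(u - b) / \<epsilon>\<rfloor> .. \<lceil>(v - b) / \<epsilon>\<rceil>}"
      using k by blast
  qed
qed simp

text \<open>The case distinction in \<open>sturm\<close> is the carry in the floor of a sum. In this
  form the exponents count integers between consecutive heights of the line, and their sums
  telescope.\<close>

lemma sturm_floor:
  assumes "m > 0"
  shows "int (sturm m y0 k) = \<lfloor>y0 + real k * m\<rfloor> - \<lfloor>y0 + (real k - 1) * m\<rfloor>"
proof -
  have "y0 + real k * m = (y0 + (real k - 1) * m) + m" by (simp add: algebra_simps)
  then show ?thesis using assms
    by (simp only: floor_add[of "y0 + (real k - 1) * m" m]) (auto simp: sturm_def)
qed

lemma sum_sturm:
  assumes "m > 0"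
  shows "int (\<Sum>k=1..n. sturm m y0 k) = \<lfloor>y0 + real n * m\<rfloor> - \<lfloor>y0\<rfloor>"
proof (induction n)
  case (Suc n)
  then show ?case using sturm_floor[OF assms, of y0 "Suc n"] by simp
qed simp

lemma length_blocks:
  "length (concat (map (\<lambda>i. block (c i) (n i)) [1..<s+1])) = s + (\<Sum>i=1..s. n i)"
  by (induction s) (auto simp: block_def)

text \<open>Treats the planetary word as a lemniscate word with empty blocks, so that both winding
  types share one block decomposition.\<close>

lemma word_P_alternating:
  "word_P q = word_L (\<lambda>_. 0) (2 * q)"
proof (induction q)
  case (Suc q)
  have "word_P (Suc q) = word_P q @ [1, 2]"
    by (simp add: word_P_def flip: replicate_append_same)
  then show ?case using Suc by (simp add: word_L_def block_def)
qed (simp add: word_P_def word_L_def)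

lemma cos_eq_0_iff_sin:
  fixes x :: real
  shows "cos x = 0 \<longleftrightarrow> sin x = 1 \<or> sin x = -1"
proof -
  have "cos x = 0 \<longleftrightarrow> (cos x)\<^sup>2 = 0" by simp
  also have "\<dots> \<longleftrightarrow> (sin x)\<^sup>2 = 1" unfolding cos_squared_eq by auto
  finally show ?thesis by (simp add: power2_eq_1_iff)
qed

text \<open>One period, read from \<open>t0\<close>, is cut at the crossings. Each half-open piece
  begins with a letter 1 or 2 at its left end, which is not a zero of \<open>lam\<close> because
  there are no collisions, and then contains only 3's. The zeros of \<open>lam\<close> may be
  absent, so planetary orbits are included.\<close>

lemma syzygy_word_blocks:
  fixes lam nu :: "real \<Rightarrow> real" and c :: "nat \<Rightarrow> nat"
  assumes \<delta>: "\<delta> > 0" and N: "T = real N * \<delta>"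
    and cross: "{t. cos (nu t) = 0} = range (\<lambda>k::int. t0 + of_int k * \<delta>)"
    and t0: "0 \<le> t0" "t0 < T"
    and fin: "\<And>u v. finite ({t. lam t = 0} \<inter> {u..<v})"
    and nocoll: "\<And>t. \<not> (lam t = 0 \<and> cos (nu t) = 0)"
    and lam: "\<And>t. lam (t + T) = lam t" and sin: "\<And>t. sin (nu (t + T)) = sin (nu t)"
    and c: "\<And>i. syzygy_symbol lam nu (t0 + (real i - 1) * \<delta>) = c i"
  shows "finite (syzygy_times lam nu T)"
    and "\<exists>k. syzygy_word lam nu T = rotate k (concat (map (\<lambda>i. block (c i)
           (card ({t. lam t = 0} \<inter> {t0 + (real i - 1) * \<delta><..<t0 + real i * \<delta>}))) [1..<N+1]))"
proof -
  let ?Z = "{t. lam t = 0}" and ?C = "{t. cos (nu t) = 0}"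
  let ?\<sigma> = "syzygy_symbol lam nu"
  define S where "S = ?Z \<union> ?C"
  have times: "syzygy_times lam nu T = S \<inter> {0..<T}"
    by (auto simp: syzygy_times_def S_def cos_eq_0_iff_sin)
  have finS: "finite (S \<inter> {u..<v})" for u v
    using fin finite_arithmetic_progression_Int[OF \<delta>]
    unfolding S_def cross by (simp add: Int_Un_distrib2)
  then show "finite (syzygy_times lam nu T)" by (simp add: times)
  have "\<exists>k. map ?\<sigma> (sorted_list_of_set (S \<inter> {0..<T}))
      = rotate k (map ?\<sigma> (sorted_list_of_set (S \<inter> {t0..<t0 + T})))"
    by (rule periodic_word_rotate[OF finS _ _ t0])
      (auto simp: S_def cos_eq_0_iff_sin lam sin syzygy_symbol_def)
  moreover have "map ?\<sigma> (sorted_list_of_set (S \<inter> {t0..<t0 + T})) = concat (map (\<lambda>i. block (c i)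
      (card (?Z \<inter> {t0 + (real i - 1) * \<delta><..<t0 + real i * \<delta>}))) [1..<N+1])"
  proof -
    have "map ?\<sigma> (sorted_list_of_set (S \<inter> {t0 + (real i - 1) * \<delta>..<t0 + real i * \<delta>})) =
        block (c i) (card (?Z \<inter> {t0 + (real i - 1) * \<delta><..<t0 + real i * \<delta>}))" for i
    proof -
      let ?a = "t0 + (real i - 1) * \<delta>" and ?b = "t0 + real i * \<delta>"
      \<comment> \<open>Block \<open>i\<close> opens at crossing number \<open>i - 1\<close>: blocks
        are indexed from 1, as in \<open>sturm\<close>, and crossings from 0.\<close>
      have aC: "?a \<in> ?C" unfolding cross by (rule range_eqI[of _ _ "int i - 1"]) simp
      have C: "?C \<inter> {?a..<?b} = {?a}"
      proof (intro equalityI subsetI)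
        fix t assume "t \<in> ?C \<inter> {?a..<?b}"
        then obtain k :: int where k: "t = t0 + of_int k * \<delta>" "?a \<le> t" "t < ?b"
          unfolding cross by auto
        then have "real_of_int (int i - 1) \<le> of_int k" "of_int k < real_of_int (int i)"
          using \<delta> by auto
        then have "k = int i - 1" by linarith
        then show "t \<in> {?a}" using k by simp
      next
        fix t assume "t \<in> {?a}"
        then have "t = ?a" "?b = ?a + \<delta>" by (simp_all add: algebra_simps)
        then show "t \<in> ?C \<inter> {?a..<?b}" using aC \<delta> by simp
      qed
      have "S \<inter> {?a..<?b} = {?a} \<union> (?Z \<inter> {?a<..<?b})" (is "_ = _ \<union> ?M")
      proof -
        have "lam ?a \<noteq> 0" using aC nocoll[of ?a] by simp
        then have "?Z \<inter> {?a..<?b} = ?M" by (force simp: less_le)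
        then show ?thesis unfolding S_def Int_Un_distrib2 C by blast
      qed
      moreover have "finite ?M" by (rule finite_subset[OF _ fin[of ?a ?b]]) auto
      ultimately have "sorted_list_of_set (S \<inter> {?a..<?b}) = ?a # sorted_list_of_set ?M"
        using sorted_list_of_set_Un_less[of "{?a}" ?M] by simp
      moreover have "map ?\<sigma> (sorted_list_of_set ?M) = replicate (card ?M) 3"
      proof -
        have "map ?\<sigma> (sorted_list_of_set ?M) = map (\<lambda>_. 3) (sorted_list_of_set ?M)"
          using \<open>finite ?M\<close> by (intro map_cong) (auto simp: syzygy_symbol_def)
        then show ?thesis using \<open>finite ?M\<close> by (simp add: map_replicate_const)
      qed
      ultimately show ?thesis by (simp add: block_def c)
    qed
    then show ?thesis
      unfolding N sorted_list_of_set_blocks[OF \<delta> finS] by (simp add: map_concat o_def)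
  qed
  ultimately show "\<exists>k. syzygy_word lam nu T = rotate k (concat (map (\<lambda>i. block (c i)
           (card ({t. lam t = 0} \<inter> {t0 + (real i - 1) * \<delta><..<t0 + real i * \<delta>}))) [1..<N+1]))"
    by (simp add: syzygy_word_def times)
qed

text \<open>The affine time scale sending \<open>b\<close> to 0 and \<open>b + \<epsilon>\<close> to
  1 puts the zeros of \<open>lam\<close> at the integers and the crossings at
  \<open>y0 + k * m\<close>, with \<open>m\<close> the ratio of the steps. For half periods as
  steps, \<open>m\<close> is the rotation number.\<close>

lemma syzygy_word_sturm:
  fixes lam nu :: "real \<Rightarrow> real" and c :: "nat \<Rightarrow> nat" and p q :: nat
  assumes \<delta>: "\<delta> > 0" and \<epsilon>: "\<epsilon> > 0"
    and T: "T = real (2 * q) * \<delta>" "T = real (2 * p) * \<epsilon>"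
    and cross: "{t. cos (nu t) = 0} = range (\<lambda>k::int. t0 + of_int k * \<delta>)"
    and zeros: "{t. lam t = 0} = range (\<lambda>k::int. b + of_int k * \<epsilon>)"
    and t0: "0 \<le> t0" "t0 < T"
    and nocoll: "\<And>t. \<not> (lam t = 0 \<and> cos (nu t) = 0)"
    and lam: "\<And>t. lam (t + T) = lam t" and sin: "\<And>t. sin (nu (t + T)) = sin (nu t)"
    and c: "\<And>i. syzygy_symbol lam nu (t0 + (real i - 1) * \<delta>) = c i"
  shows "finite (syzygy_times lam nu T)"
    and "length (syzygy_word lam nu T) = 2 * (p + q)"
    and "\<exists>y0 k. line_avoids_lattice (\<delta> / \<epsilon>) y0 \<and> syzygy_word lam nu T =
           rotate k (concat (map (\<lambda>i. block (c i) (sturm (\<delta> / \<epsilon>) y0 i)) [1..<2*q+1]))"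
proof -
  have fin: "finite ({t. lam t = 0} \<inter> {u..<v})" for u v
    unfolding zeros by (rule finite_arithmetic_progression_Int[OF \<epsilon>])
  note blocks = syzygy_word_blocks[OF \<delta> T(1) cross t0 fin nocoll lam sin c]
  show "finite (syzygy_times lam nu T)" by (rule blocks)
  define m where "m = \<delta> / \<epsilon>"
  define y0 where "y0 = (t0 - b) / \<epsilon>"
  have m: "m > 0" using \<delta> \<epsilon> by (simp add: m_def)
  have disj: "t0 + of_int a * \<delta> \<noteq> b + of_int k * \<epsilon>" for a k :: int
    using nocoll cross zeros by blast
  \<comment> \<open>A lattice point on the line would be a zero of \<open>lam\<close> at a crossing
    time, hence a collision.\<close>
  have avoid: "line_avoids_lattice m y0"
    unfolding line_avoids_lattice_def
  proof (intro allI notI)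
    fix a k :: int assume "of_int k = m * of_int a + y0"
    then have "of_int k * \<epsilon> = (m * of_int a + y0) * \<epsilon>" by simp
    also have "\<dots> = of_int a * \<delta> + (t0 - b)"
      using \<epsilon> by (simp add: m_def y0_def distrib_right)
    finally have "of_int k * \<epsilon> = of_int a * \<delta> + (t0 - b)" .
    then show False using disj[of a k] by simp
  qed
  have "card ({t. lam t = 0} \<inter> {t0 + (real i - 1) * \<delta><..<t0 + real i * \<delta>}) = sturm m y0 i" for i
  proof -
    have "t0 + real i * \<delta> \<notin> range (\<lambda>k::int. b + of_int k * \<epsilon>)"
      using disj[of "int i"] by auto
    moreover have "(t0 + r * \<delta> - b) / \<epsilon> = y0 + r * m" for r
      by (simp add: y0_def m_def add_divide_distrib diff_divide_distrib)
    ultimately have "card ({t. lam t = 0} \<inter> {t0 + (real i - 1) * \<delta><..<t0 + real i * \<delta>})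
        = nat (\<lfloor>y0 + real i * m\<rfloor> - \<lfloor>y0 + (real i - 1) * m\<rfloor>)"
      unfolding zeros by (subst card_arithmetic_progression_Int[OF \<epsilon>]) auto
    then show ?thesis using sturm_floor[OF m, of y0 i] by simp
  qed
  then obtain k where k: "syzygy_word lam nu T =
      rotate k (concat (map (\<lambda>i. block (c i) (sturm m y0 i)) [1..<2*q+1]))"
    using blocks(2) by auto
  then show "\<exists>y0 k. line_avoids_lattice (\<delta> / \<epsilon>) y0 \<and> syzygy_word lam nu T =
           rotate k (concat (map (\<lambda>i. block (c i) (sturm (\<delta> / \<epsilon>) y0 i)) [1..<2*q+1]))"
    using avoid unfolding m_def by blast
  \<comment> \<open>Over one period the line rises by the integer \<open>2 * p\<close>, so the
    telescoped floor sum equals it exactly.\<close>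
  have "real (2 * q) * m = of_int (2 * int p)"
    using T \<epsilon> by (simp add: m_def field_simps)
  then have "int (\<Sum>i=1..2*q. sturm m y0 i) = \<lfloor>y0 + of_int (2 * int p)\<rfloor> - \<lfloor>y0\<rfloor>"
    by (simp only: sum_sturm[OF m])
  then have "int (\<Sum>i=1..2*q. sturm m y0 i) = 2 * int p" by (simp only: floor_add_int[symmetric])
  then have "(\<Sum>i=1..2*q. sturm m y0 i) = 2 * p" by linarith
  then show "length (syzygy_word lam nu T) = 2 * (p + q)"
    unfolding k length_rotate length_blocks by simp
qed

section \<open>Motion on the cylinder\<close>

lemma IVT_sign:
  fixes f :: "real \<Rightarrow> real"
  assumes cont: "continuous_on UNIV f" and ne: "\<And>t. f t \<noteq> c"
  shows "(\<forall>t. f t > c) \<or> (\<forall>t. f t < c)"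
proof (rule ccontr)
  assume "\<not> ?thesis"
  then obtain s t where st: "f s < c" "c < f t" using ne by (meson linorder_cases)
  have "connected (range f)" by (rule connected_continuous_image[OF cont]) simp
  then have "c \<in> range f"
    using st connectedD_interval[of "range f" "f s" "f t" c] by simp
  then show False using ne by blast
qed

lemma Rolle_periodic:
  fixes f :: "real \<Rightarrow> real"
  assumes "\<And>t. (f has_real_derivative f' t) (at t)" and "f T = f 0" and "T > 0"
  obtains t where "f' t = 0"
proof -
  have "\<exists>t. 0 < t \<and> t < T \<and> f T - f 0 = (T - 0) * f' t"
    by (rule MVT2) (use assms in auto)
  then show ?thesis using assms that by auto
qed

section \<open>Newton's equation modulo 2 pi, and its symmetry about a crossing\<close>

lemma cyl_of_eq_iff:
  "cyl_of (x, p) = cyl_of (y, r) \<longleftrightarrow> (\<exists>n::int. x = y + 2 * pi * of_int n) \<and> p = r"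
  using sin_cos_eq_iff[of x y] by (auto simp: cyl_of_def)

text \<open>Lifts of the same point differ by a multiple of 2 pi; translation by it preserves
  solutions, so uniqueness keeps the difference constant.\<close>

lemma newton_cyl_det:
  assumes f: "\<And>u. (f has_real_derivative f' u) (at u)" and f': "continuous_on UNIV f'"
    and x: "newton f x p" and f_per: "\<And>u (n::int). f (u + 2 * pi * of_int n) = f u"
    and eq: "cyl_of (x s, p s) = cyl_of (x t, p t)"
  shows "cyl_of (x (s + r), p (s + r)) = cyl_of (x (t + r), p (t + r))"
proof -
  obtain n :: int where n: "x s = x t + 2 * pi * of_int n" "p s = p t"
    using eq by (auto simp: cyl_of_eq_iff)
  have "x (s + r) = x (t + r) + 2 * pi * of_int n \<and> p (s + r) = p (t + r)"
    using newton_unique[OF f f' newton_shift[OF x]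
        newton_translate[OF newton_shift[OF x] f_per], of s 0 t n r] n by simp
  then show ?thesis by (auto simp: cyl_of_eq_iff)
qed

text \<open>Reversing time about \<open>t0\<close> and reflecting the position in
  \<open>x t0\<close> each flip the velocity, so the composite is a solution with the original
  initial data.\<close>

lemma newton_odd_symmetry:
  assumes f: "\<And>u. (f has_real_derivative f' u) (at u)" and f': "continuous_on UNIV f'"
    and x: "newton f x p" and odd: "\<And>u. f (2 * x t0 - u) = - f u"
  shows "x (t0 + s) = 2 * x t0 - x (t0 - s)"
  using newton_unique[OF f f' newton_shift[OF x, of t0]
      newton_reflect[OF newton_reverse[OF x, of t0] odd], of 0 s] by simp

text \<open>The positions half a period before and after a crossing are mirror images, so their
  cosines are opposite; by periodicity these cosines are also equal, hence 0.\<close>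

lemma pendulum_half_period:
  assumes f: "\<And>u. (f has_real_derivative f' u) (at u)" and f': "continuous_on UNIV f'"
    and x: "newton f x p"
    and f_odd: "\<And>u (n::int). f (pi + 2 * pi * of_int n - u) = - f u"
    and per: "min_period (\<lambda>t. cyl_of (x t, p t)) P" and t0: "cos (x t0) = 0"
  shows "cos (x (t0 + P / 2)) = 0"
proof -
  obtain n :: int where n: "x t0 = of_int n * pi + pi / 2"
    using t0 by (auto simp: cos_zero_iff_int2)
  then have c: "2 * x t0 = pi + 2 * pi * of_int n" by (simp add: algebra_simps)
  have "x (t0 + P / 2) = (pi - x (t0 - P / 2)) + 2 * pi * of_int n"
    using newton_odd_symmetry[OF f f' x, of t0 "P / 2"] f_odd by (simp add: c)
  then have "cos (x (t0 + P / 2)) = cos (pi - x (t0 - P / 2))"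
    using sin_cos_eq_iff by metis
  also have "\<dots> = - cos (x (t0 - P / 2))" by simp
  also have "cos (x (t0 - P / 2)) = cos (x (t0 + P / 2))"
  proof -
    have "cyl_of (x (t0 - P / 2 + P), p (t0 - P / 2 + P)) = cyl_of (x (t0 - P / 2), p (t0 - P / 2))"
      using per unfolding min_period_def by blast
    moreover have "t0 - P / 2 + P = t0 + P / 2" by simp
    ultimately show ?thesis by (simp add: cyl_of_def)
  qed
  finally show ?thesis by simp
qed

section \<open>Regular levels and contractibility\<close>

text \<open>On zero momentum the differential reduces to the slope of the potential, so regularity
  makes that slope nonzero.\<close>

lemma Hnu_critical:
  assumes "regular_value (Hnu d m1 m2 h) g" and "Hnu d m1 m2 h (v, 0) = g"
  shows "d * (m1 - m2) * cos v + 2 * h * d\<^sup>2 * sin v * cos v \<noteq> 0"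
proof
  assume z: "d * (m1 - m2) * cos v + 2 * h * d\<^sup>2 * sin v * cos v = 0"
  obtain D where D: "(Hnu d m1 m2 h has_derivative D) (at (v, 0))" "D \<noteq> (\<lambda>_. 0)"
    using assms by (auto simp: regular_value_def)
  have H: "Hnu d m1 m2 h =
      (\<lambda>z. (snd z)\<^sup>2 / 2 + d * (m1 - m2) * sin (fst z) + h * d\<^sup>2 * (sin (fst z))\<^sup>2)"
    by (auto simp: Hnu_def fun_eq_iff)
  have "(Hnu d m1 m2 h has_derivative
      (\<lambda>w. (d * (m1 - m2) * cos v + 2 * h * d\<^sup>2 * sin v * cos v) * fst w)) (at (v, 0))"
    unfolding H by (rule derivative_eq_intros refl | simp add: algebra_simps)+
  then have "D = (\<lambda>w. (d * (m1 - m2) * cos v + 2 * h * d\<^sup>2 * sin v * cos v) * fst w)"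
    using D(1) has_derivative_unique by blast
  then show False using z D(2) by simp
qed

text \<open>The potential is even in \<open>l\<close>, so the origin is a critical point. This rules
  out motion exactly at the energy of the barrier at \<open>l = 0\<close>.\<close>

lemma Hlam_critical:
  assumes "regular_value (Hlam d m1 m2 h) g"
  shows "Hlam d m1 m2 h (0, 0) \<noteq> g"
proof
  assume "Hlam d m1 m2 h (0, 0) = g"
  then obtain D where D: "(Hlam d m1 m2 h has_derivative D) (at (0, 0))" "D \<noteq> (\<lambda>_. 0)"
    using assms by (auto simp: regular_value_def)
  have H: "Hlam d m1 m2 h =
      (\<lambda>z. (snd z)\<^sup>2 / 2 - d * (m1 + m2) * cosh (fst z) - h * d\<^sup>2 * (cosh (fst z))\<^sup>2)"
    by (auto simp: Hlam_def fun_eq_iff)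
  have [derivative_intros]:
    "((\<lambda>z::real \<times> real. cosh (fst z)) has_derivative
        (\<lambda>w. fst w * sinh (fst (0::real, 0::real)))) (at (0, 0))"
    by (rule DERIV_compose_FDERIV[OF has_field_derivative_cosh[OF DERIV_ident, simplified]
          has_derivative_fst[OF has_derivative_ident]])
  have "(Hlam d m1 m2 h has_derivative (\<lambda>w. 0)) (at (0, 0))"
    unfolding H by (rule derivative_eq_intros refl | simp add: algebra_simps)+
  then show False using D has_derivative_unique by blast
qed

text \<open>Cutting the cylinder along the line over \<open>arcsin s0\<close> gives a continuous
  angle \<open>F\<close> on \<open>C\<close>. The inclusion of \<open>C\<close> then factors through
  the plane, which is contractible.\<close>

lemma cylinder_minus_line_nullhomotopic:
  fixes C :: "(real \<times> real \<times> real) set"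
  assumes C: "C \<subseteq> cylinder" and s0: "\<bar>s0\<bar> \<le> 1" and ne: "\<And>c s p. (c, s, p) \<in> C \<Longrightarrow> s \<noteq> s0"
  shows "\<exists>a. homotopic_with_canon (\<lambda>_. True) C cylinder id (\<lambda>_. a)"
proof -
  define v0 where "v0 = arcsin s0"
  have sv0: "sin v0 = s0" using s0 by (simp add: v0_def abs_le_iff)
  \<comment> \<open>The rotation puts the omitted direction \<open>v0\<close> on the nonnegative
    real axis, where \<open>Arg2pi\<close> jumps.\<close>
  define w where "w = (\<lambda>z::real \<times> real \<times> real. Complex (fst z) (fst (snd z)) * cis (- v0))"
  define F where "F = (\<lambda>z::real \<times> real \<times> real. (v0 + Arg2pi (w z), snd (snd z)))"
  have w: "w (cyl_of (v, p)) = cis (v - v0)" for v p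
    by (simp add: w_def cyl_of_def cis_mult flip: cis.code)
  have notpos: "w z \<notin> \<real>\<^sub>\<ge>\<^sub>0" if z: "z \<in> C" for z
  proof
    assume pos: "w z \<in> \<real>\<^sub>\<ge>\<^sub>0"
    obtain v p where vp: "z = cyl_of (v, p)" using z C by (auto simp: cylinder_def)
    have "sin (v - v0) = 0" "cos (v - v0) \<ge> 0"
      using pos by (auto simp: vp w complex_nonneg_Reals_iff)
    then have "cos (v - v0) = 1"
      using sin_cos_squared_add[of "v - v0"] by (simp add: power2_eq_1_iff)
    then have "sin ((v - v0) + v0) = s0"
      using \<open>sin (v - v0) = 0\<close> by (simp only: sin_add) (simp add: sv0)
    then show False using ne[of "cos v" "sin v" p] z vp by (simp add: cyl_of_def)
  qed
  have contw: "continuous_on C w" unfolding w_def Complex_eq by (intro continuous_intros)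
  have "continuous_on C (\<lambda>z. Arg2pi (w z))"
    using contw notpos unfolding continuous_on_eq_continuous_within
    by (blast intro: continuous_within_compose3[OF continuous_at_Arg2pi])
  then have contF: "continuous_on C F" unfolding F_def by (intro continuous_intros)
  have FC: "cyl_of (F z) = z" if z: "z \<in> C" for z
  proof -
    obtain v p where vp: "z = cyl_of (v, p)" using z C by (auto simp: cylinder_def)
    have "cis (Arg2pi (w z)) = w z"
      using Arg2pi_eq[of "w z"] by (simp add: vp w cis_conv_exp)
    then have "cis (v0 + Arg2pi (w z)) = cis v"
      by (simp add: vp w cis_mult flip: cis_mult[of v0 "Arg2pi _"])
    then show ?thesis by (simp add: vp F_def cyl_of_def complex_eq_iff)
  qed
  have contcyl: "continuous_on UNIV cyl_of"
    unfolding cyl_of_def case_prod_beta by (intro continuous_intros)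
  obtain a where "homotopic_with_canon (\<lambda>_. True) C cylinder (cyl_of \<circ> F) (\<lambda>_. a)"
    using nullhomotopic_through_contractible[OF contF _ contcyl, of cylinder]
    by (auto simp: cylinder_def)
  then have "homotopic_with_canon (\<lambda>_. True) C cylinder id (\<lambda>_. a)"
    by (rule homotopic_with_eq) (auto simp: FC)
  then show ?thesis by blast
qed

text \<open>A null-homotopy of \<open>C\<close>, restricted to the graph of \<open>V\<close> and
  projected back to the circle, would contract the circle.\<close>

lemma winding_not_nullhomotopic:
  assumes V: "continuous_on UNIV V"
    and sub: "(\<lambda>(c, s). (c, s, V s)) ` sphere (0, 0) 1 \<subseteq> C"
  shows "\<not> (\<exists>a. homotopic_with_canon (\<lambda>_. True) C cylinder id (\<lambda>_. a :: real \<times> real \<times> real))"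
proof
  let ?S = "sphere (0 :: real \<times> real) 1"
  let ?g = "\<lambda>(c, s). (c, s, V s :: real)" and ?\<pi> = "\<lambda>z :: real \<times> real \<times> real. (fst z, fst (snd z))"
  assume "\<exists>a. homotopic_with_canon (\<lambda>_. True) C cylinder id (\<lambda>_. a)"
  then obtain a where a: "homotopic_with_canon (\<lambda>_. True) C cylinder id (\<lambda>_. a)" by blast
  have cg: "continuous_on ?S ?g"
    unfolding case_prod_beta
    by (intro continuous_intros continuous_on_compose2[OF V]) auto
  have "homotopic_with_canon (\<lambda>_. True) ?S cylinder (id \<circ> ?g) ((\<lambda>_. a) \<circ> ?g)"
    by (rule homotopic_with_compose_continuous_right[OF a cg]) (use sub in \<open>auto simp: zero_prod_def\<close>)
  then have "homotopic_with_canon (\<lambda>_. True) ?S ?S (?\<pi> \<circ> (id \<circ> ?g)) (?\<pi> \<circ> ((\<lambda>_. a) \<circ> ?g))"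
    by (rule homotopic_with_compose_continuous_left)
      (auto intro!: continuous_intros simp: cylinder_def cyl_of_def norm_Pair)
  then have "homotopic_with_canon (\<lambda>_. True) ?S ?S id (\<lambda>_. ?\<pi> a)"
    by (rule homotopic_with_eq) auto
  then have "contractible ?S" unfolding contractible_def by blast
  then show False by (simp add: contractible_sphere)
qed

section \<open>Crossing times of the two separated motions\<close>

text \<open>Every state is attained on the compact interval \<open>{0..T}\<close>. This supplies the
  turning points in \<open>lam_reaches_zero\<close>.\<close>

lemma min_period_attains_bounds:
  fixes F :: "'a \<Rightarrow> real"
  assumes mp: "min_period \<phi> T" and cont: "continuous_on UNIV (\<lambda>t. F (\<phi> t))"
  obtains r s where "\<And>t. F (\<phi> r) \<le> F (\<phi> t)" "\<And>t. F (\<phi> t) \<le> F (\<phi> s)"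
proof -
  have T: "T > 0" using mp by (simp add: min_period_def)
  have c: "continuous_on {0..T} (\<lambda>t. F (\<phi> t))" using cont continuous_on_subset by blast
  obtain r where r: "\<forall>t\<in>{0..T}. F (\<phi> r) \<le> F (\<phi> t)"
    using continuous_attains_inf[OF _ _ c] T by fastforce
  obtain s where s: "\<forall>t\<in>{0..T}. F (\<phi> t) \<le> F (\<phi> s)"
    using continuous_attains_sup[OF _ _ c] T by fastforce
  have "\<exists>t'\<in>{0..T}. \<phi> t = \<phi> t'" for t
  proof
    let ?k = "\<lfloor>t / T\<rfloor>"
    show "\<phi> t = \<phi> (t - of_int ?k * T)"
      using min_period_int[OF mp, of "t - of_int ?k * T" ?k] by simp
    show "t - of_int ?k * T \<in> {0..T}"
      using floor_divide_lower[OF T, of t] floor_divide_upper[OF T, of t]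
      by (simp add: distrib_right)
  qed
  then show ?thesis using r s that by metis
qed

lemma range_progression_shift:
  fixes t0 \<delta> :: real and j :: int
  shows "range (\<lambda>k::int. t0 + of_int j * \<delta> + of_int k * \<delta>) = range (\<lambda>k::int. t0 + of_int k * \<delta>)"
proof (intro equalityI subsetI)
  fix t assume "t \<in> range (\<lambda>k::int. t0 + of_int j * \<delta> + of_int k * \<delta>)"
  then obtain k :: int where "t = t0 + of_int j * \<delta> + of_int k * \<delta>" by blast
  then have "t = t0 + of_int (j + k) * \<delta>" by (simp add: distrib_right)
  then show "t \<in> range (\<lambda>k::int. t0 + of_int k * \<delta>)" by blast
next
  fix t assume "t \<in> range (\<lambda>k::int. t0 + of_int k * \<delta>)"
  then obtain k :: int where "t = t0 + of_int k * \<delta>" by blast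
  then have "t = t0 + of_int j * \<delta> + of_int (k - j) * \<delta>" by (simp add: left_diff_distrib)
  then show "t \<in> range (\<lambda>k::int. t0 + of_int j * \<delta> + of_int k * \<delta>)" by blast
qed

text \<open>In the application \<open>A = d * (m1 + m2)\<close>, \<open>a = d * (m1 - m2)\<close>
  and \<open>B = h * d\<^sup>2\<close>, which is negative. Both forces are minus the derivative of
  the potential in \<open>Hlam\<close> or \<open>Hnu\<close>.\<close>

definition lam_force :: "real \<Rightarrow> real \<Rightarrow> real \<Rightarrow> real" where
  "lam_force A B u = A * sinh u + 2 * B * cosh u * sinh u"

definition nu_force :: "real \<Rightarrow> real \<Rightarrow> real \<Rightarrow> real" where
  "nu_force a B u = - (a * cos u + 2 * B * sin u * cos u)"

lemma lam_force_deriv: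
  "(lam_force A B has_real_derivative A * cosh u + 2 * B * (sinh u * sinh u + cosh u * cosh u)) (at u)"
  unfolding lam_force_def by (auto intro!: derivative_eq_intros simp: algebra_simps)

lemma nu_force_deriv:
  "(nu_force a B has_real_derivative a * sin u - 2 * B * (cos u * cos u - sin u * sin u)) (at u)"
  unfolding nu_force_def by (auto intro!: derivative_eq_intros simp: algebra_simps)

lemma continuous_lam_force_deriv:
  "continuous_on UNIV (\<lambda>u::real. A * cosh u + 2 * B * (sinh u * sinh u + cosh u * cosh u))"
  by (intro continuous_intros)

lemma continuous_nu_force_deriv:
  "continuous_on UNIV (\<lambda>u::real. a * sin u - 2 * B * (cos u * cos u - sin u * sin u))"
  by (intro continuous_intros)

lemma nu_force_periodic: "nu_force a B (u + 2 * pi * of_int n) = nu_force a B u"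
  using sin_cos_eq_iff[of "u + 2 * pi * of_int n" u] by (auto simp: nu_force_def)

lemma nu_force_odd: "nu_force a B (pi + 2 * pi * of_int n - u) = - nu_force a B u"
  using nu_force_periodic[of a B "pi - u" n]
  by (simp add: nu_force_def algebra_simps)

text \<open>The potential is strictly convex in \<open>cosh \<lambda>\<close>, so an orbit avoiding \<open>\<lambda> = 0\<close> would have
  two turning values of \<open>cosh \<lambda>\<close> above 1, both at higher potential than the value 1.\<close>

lemma lam_reaches_zero:
  assumes lam: "newton (lam_force A B) lam plam"
    and per: "min_period (\<lambda>t. (lam t, plam t)) P"
    and energy: "\<And>t. (plam t)\<^sup>2 / 2 - A * cosh (lam t) - B * (cosh (lam t))\<^sup>2 = e"
    and B: "B < 0" and e: "- A - B < e"
  shows "\<exists>t. lam t = 0"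
proof (rule ccontr)
  assume "\<not> ?thesis"
  then have ne: "lam t \<noteq> 0" for t by blast
  define C where "C = (\<lambda>t. cosh (lam t))"
  have dlam: "(lam has_real_derivative plam t) (at t)" for t using lam by (simp add: newton_def)
  have dC: "(C has_real_derivative sinh (lam t) * plam t) (at t)" for t
    unfolding C_def using dlam[of t] by (auto intro!: derivative_eq_intros)
  have "continuous_on UNIV (\<lambda>t. cosh (fst (lam t, plam t)))"
    using dC unfolding C_def fst_conv by (meson DERIV_isCont continuous_at_imp_continuous_on)
  from min_period_attains_bounds[OF per this]
  obtain r s where rs: "\<And>t. C r \<le> C t" "\<And>t. C t \<le> C s" unfolding C_def by auto
  have "sinh (lam r) * plam r = 0"
    by (rule DERIV_local_min[OF dC, of 1]) (use rs in auto)
  moreover have "sinh (lam s) * plam s = 0"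
    by (rule DERIV_local_max[OF dC, of 1]) (use rs in auto)
  ultimately have pz: "plam r = 0" "plam s = 0" using ne by auto
  \<comment> \<open>Constant \<open>cosh lam\<close> would make the orbit an equilibrium, which has
    no minimal period.\<close>
  have "C r \<noteq> C s"
  proof
    assume "C r = C s"
    then have Cc: "C y \<le> C t" for y t using rs(2)[of y] rs(1)[of t] by linarith
    have "sinh (lam t) * plam t = 0" for t
      by (rule DERIV_local_max[OF dC, of 1]) (use Cc in auto)
    then have p0: "plam t = 0" for t using ne by auto
    then have "lam s = lam t" for s t using dlam DERIV_isconst_all by metis
    then have "(lam (t + P / 2), plam (t + P / 2)) = (lam t, plam t)" for t
      using p0 by simp
    moreover have "0 < P / 2" "P / 2 < P" using per by (auto simp: min_period_def)
    ultimately show False using per unfolding min_period_def by blast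
  qed
  then have lt: "C r < C s" using rs[of s] by simp
  have "cosh (lam r) \<noteq> 1" using ne[of r] by simp
  then have C1: "C r > 1" using cosh_real_ge_1[of "lam r"] unfolding C_def by linarith
  have E: "- A * C r - B * (C r)\<^sup>2 = e" "- A * C s - B * (C s)\<^sup>2 = e"
    using energy[of r] energy[of s] pz by (simp_all add: C_def)
  \<comment> \<open>Both turning values are roots of the same quadratic, so their sum is known and
    \<open>A\<close> can be eliminated.\<close>
  have "(C s - C r) * (- A - B * (C s + C r)) = 0"
    using E by (simp add: algebra_simps power2_eq_square)
  then have A: "A = - B * (C s + C r)" using lt by simp
  have "e - (- A - B) = (C r - 1) * (- B) * (1 - C s)"
    unfolding E(1)[symmetric] A by (simp add: algebra_simps power2_eq_square)
  moreover have "(C r - 1) * (- B) * (1 - C s) < 0"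
    using C1 B lt by (intro mult_pos_neg mult_pos_pos) auto
  ultimately show False using e by linarith
qed

text \<open>Energy fixes the momentum at a zero up to sign, which leaves two crossing states.
  Oddness of the motion about \<open>t0\<close> and periodicity give
  \<open>lam (t0 + P / 2) = - lam (t0 + P / 2)\<close>.\<close>

lemma lam_zeros:
  assumes lam: "newton (lam_force A B) lam plam"
    and per: "min_period (\<lambda>t. (lam t, plam t)) P"
    and energy: "\<And>t. (plam t)\<^sup>2 / 2 - A * cosh (lam t) - B * (cosh (lam t))\<^sup>2 = e"
    and B: "B < 0" and e: "- A - B < e"
  shows "\<exists>b. {t. lam t = 0} = range (\<lambda>k::int. b + of_int k * (P / 2))"
proof -
  obtain t0 where t0: "lam t0 = 0" using lam_reaches_zero[OF assms] by blast
  note uniq = newton_unique[OF lam_force_deriv continuous_lam_force_deriv]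
  have "{t. fst (lam t, plam t) = 0} = range (\<lambda>k::int. t0 + of_int k * (P / 2))"
  proof (rule half_period_crossings(1)[OF per, where Z = "\<lambda>z. fst z = 0" and A = "(0, - plam t0)"])
    show "(lam (s + r), plam (s + r)) = (lam (t + r), plam (t + r))"
      if "(lam s, plam s) = (lam t, plam t)" for s t r
      using uniq[OF newton_shift[OF lam, of s] newton_shift[OF lam, of t], of 0 r] that by simp
    have "lam (t0 + P / 2) = - lam (t0 - P / 2)"
      using newton_odd_symmetry[OF lam_force_deriv continuous_lam_force_deriv lam, of t0 "P / 2"]
      by (simp add: t0 lam_force_def)
    moreover have "lam (t0 - P / 2) = lam (t0 + P / 2)"
      using min_period_int[OF per, of "t0 - P / 2" 1] by (simp add: add.commute)
    ultimately show "fst (lam (t0 + P / 2), plam (t0 + P / 2)) = 0" by simp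
    show "(lam t, plam t) = (lam t0, plam t0) \<or> (lam t, plam t) = (0, - plam t0)"
      if "fst (lam t, plam t) = 0" for t
    proof -
      have "(plam t)\<^sup>2 = (plam t0)\<^sup>2" using energy[of t] energy[of t0] that t0 by simp
      then show ?thesis using that t0 by (auto simp: power2_eq_iff)
    qed
  qed (simp add: t0)
  then show ?thesis by auto
qed

text \<open>Shared by both kinds of \<open>Cn\<close>, which differ in the second crossing state
  \<open>z\<close>: the same side with reversed momentum, or the opposite side.\<close>

lemma nu_half_period_crossings:
  assumes nu: "newton (nu_force a B) nu pnu"
    and per: "min_period (\<lambda>t. cyl_of (nu t, pnu t)) P"
    and t0: "cos (nu t0) = 0"
    and two: "\<And>t. cos (nu t) = 0 \<Longrightarrow>
      cyl_of (nu t, pnu t) = cyl_of (nu t0, pnu t0) \<or> cyl_of (nu t, pnu t) = z"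
  shows "{t. cos (nu t) = 0} = range (\<lambda>k::int. t0 + of_int k * (P / 2))"
    and "cyl_of (nu (t0 + P / 2), pnu (t0 + P / 2)) \<noteq> cyl_of (nu t0, pnu t0)"
proof -
  have fst: "fst (cyl_of (v, p)) = cos v" for v p by (simp add: cyl_of_def)
  note * = half_period_crossings[OF per, where Z = "\<lambda>z. fst z = 0" and A = z and ?t0.0 = t0,
      OF newton_cyl_det[OF nu_force_deriv continuous_nu_force_deriv nu nu_force_periodic],
      unfolded fst, OF _ t0 pendulum_half_period[OF nu_force_deriv continuous_nu_force_deriv nu
        nu_force_odd per t0] two]
  show "{t. cos (nu t) = 0} = range (\<lambda>k::int. t0 + of_int k * (P / 2))" by (rule *(1))
  show "cyl_of (nu (t0 + P / 2), pnu (t0 + P / 2)) \<noteq> cyl_of (nu t0, pnu t0)" by (rule *(2))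
qed

text \<open>The forbidden value \<open>s0\<close> keeps \<open>sin nu\<close> on one side of it, so
  only one of 1 and -1 occurs, and energy leaves two momenta there. A crossing exists because, by
  Rolle, the force vanishes somewhere.\<close>

lemma nu_crossings_satellite:
  assumes nu: "newton (nu_force a B) nu pnu"
    and per: "min_period (\<lambda>t. cyl_of (nu t, pnu t)) P"
    and energy: "\<And>t. (pnu t)\<^sup>2 / 2 + a * sin (nu t) + B * (sin (nu t))\<^sup>2 = g"
    and B: "B < 0" and s0: "\<bar>s0\<bar> \<le> 1" "a * s0 + B * s0\<^sup>2 > g"
  shows "\<exists>t0 \<sigma>. {t. cos (nu t) = 0} = range (\<lambda>k::int. t0 + of_int k * (P / 2)) \<and>
           \<sigma> \<in> {-1, 1} \<and> (\<forall>t. cos (nu t) = 0 \<longrightarrow> sin (nu t) = \<sigma>)"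
proof -
  have dnu: "(nu has_real_derivative pnu t) (at t)"
    and dp: "(pnu has_real_derivative nu_force a B (nu t)) (at t)" for t
    using nu by (auto simp: newton_def)
  have le: "a * sin (nu t) + B * (sin (nu t))\<^sup>2 \<le> g" for t
    using energy[of t] zero_le_power2[of "pnu t"] by linarith
  then have ne: "sin (nu t) \<noteq> s0" for t using s0(2) by (metis not_le)
  have "pnu P = pnu 0" "P > 0"
    using min_period_int[OF per, of 0 1] per by (auto simp: cyl_of_def min_period_def)
  then obtain t0 where "nu_force a B (nu t0) = 0" using Rolle_periodic[OF dp] by blast
  then have "cos (nu t0) * (a + 2 * B * sin (nu t0)) = 0" by (simp add: nu_force_def algebra_simps)
  \<comment> \<open>The other zeros of the force are at the vertex of the potential, concave in
    \<open>sin nu\<close>; there it is at least its value at \<open>s0\<close>, hence above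
    \<open>g\<close>.\<close>
  moreover have "a + 2 * B * sin (nu t0) \<noteq> 0"
  proof
    assume "a + 2 * B * sin (nu t0) = 0"
    then have a: "a = - 2 * B * sin (nu t0)" by simp
    have "a * sin (nu t0) + B * (sin (nu t0))\<^sup>2 - (a * s0 + B * s0\<^sup>2) = - B * (sin (nu t0) - s0)\<^sup>2"
      unfolding a by (simp add: algebra_simps power2_eq_square)
    moreover have "- B * (sin (nu t0) - s0)\<^sup>2 \<ge> 0"
      using B by (intro mult_nonneg_nonneg) auto
    ultimately show False using le[of t0] s0(2) by linarith
  qed
  ultimately have t0: "cos (nu t0) = 0" by simp
  have "continuous_on UNIV nu" using dnu by (meson DERIV_isCont continuous_at_imp_continuous_on)
  then have "continuous_on UNIV (\<lambda>t. sin (nu t))" by (intro continuous_intros)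
  then have "(\<forall>t. sin (nu t) > s0) \<or> (\<forall>t. sin (nu t) < s0)" by (rule IVT_sign) (rule ne)
  then have \<sigma>: "sin (nu t) = sin (nu t0)" if "cos (nu t) = 0" for t
    using that t0 s0(1) unfolding cos_eq_0_iff_sin abs_le_iff by (smt (verit))
  have "{t. cos (nu t) = 0} = range (\<lambda>k::int. t0 + of_int k * (P / 2))"
  proof (rule nu_half_period_crossings(1)[OF nu per t0, of "(0, sin (nu t0), - pnu t0)"])
    fix t assume t: "cos (nu t) = 0"
    have "(pnu t)\<^sup>2 = (pnu t0)\<^sup>2" using energy[of t] energy[of t0] \<sigma>[OF t] by simp
    then show "cyl_of (nu t, pnu t) = cyl_of (nu t0, pnu t0) \<or>
        cyl_of (nu t, pnu t) = (0, sin (nu t0), - pnu t0)"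
      using t t0 \<sigma>[OF t] by (auto simp: cyl_of_def power2_eq_iff)
  qed
  moreover have "sin (nu t0) \<in> {-1, 1}" using t0 by (auto simp: cos_eq_0_iff_sin)
  ultimately show ?thesis using \<sigma> by blast
qed

text \<open>Above the maximum of the potential the momentum never vanishes and so keeps one sign.
  The state is thereby tied to a single branch of the level, a graph over the circle.\<close>

lemma momentum_of_sin:
  fixes nu pnu :: "real \<Rightarrow> real"
  assumes p: "continuous_on UNIV pnu"
    and energy: "\<And>t. (pnu t)\<^sup>2 / 2 + a * sin (nu t) + B * (sin (nu t))\<^sup>2 = g"
    and above: "\<And>s. \<bar>s\<bar> \<le> 1 \<Longrightarrow> a * s + B * s\<^sup>2 < g"
  shows "\<exists>\<eta>\<in>{-1, 1}. \<forall>t. pnu t = \<eta> * sqrt (2 * (g - (a * sin (nu t) + B * (sin (nu t))\<^sup>2)))"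
proof -
  have sq: "\<bar>pnu t\<bar> = sqrt (2 * (g - (a * sin (nu t) + B * (sin (nu t))\<^sup>2)))" for t
  proof -
    have "(pnu t)\<^sup>2 = 2 * (g - (a * sin (nu t) + B * (sin (nu t))\<^sup>2))" using energy[of t] by simp
    then show ?thesis by (metis real_sqrt_abs)
  qed
  have "pnu t \<noteq> 0" for t
    using energy[of t] above[of "sin (nu t)"] by auto
  then have "(\<forall>t. pnu t > 0) \<or> (\<forall>t. pnu t < 0)" by (rule IVT_sign[OF p])
  then show ?thesis
  proof
    assume "\<forall>t. pnu t > 0"
    then have "\<forall>t. pnu t = 1 * sqrt (2 * (g - (a * sin (nu t) + B * (sin (nu t))\<^sup>2)))"
      using sq by (metis abs_of_pos mult_1)
    then show ?thesis by blast
  next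
    assume "\<forall>t. pnu t < 0"
    then have "\<forall>t. pnu t = - 1 * sqrt (2 * (g - (a * sin (nu t) + B * (sin (nu t))\<^sup>2)))"
      unfolding sq[symmetric] by (simp add: abs_of_neg)
    then show ?thesis by blast
  qed
qed

text \<open>With the momentum a function of \<open>sin nu\<close>, each side of the axis allows just
  one crossing state. Half a period later the state differs, so the sides alternate.\<close>

lemma nu_crossings_winding:
  assumes nu: "newton (nu_force a B) nu pnu"
    and per: "min_period (\<lambda>t. cyl_of (nu t, pnu t)) P"
    and pG: "\<And>t. pnu t = G (sin (nu t))" and p0: "\<And>t. pnu t \<noteq> 0"
  shows "\<exists>t0. {t. cos (nu t) = 0} = range (\<lambda>k::int. t0 + of_int k * (P / 2)) \<and>
           sin (nu t0) = -1 \<and> sin (nu (t0 + P / 2)) = 1"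
proof -
  have dnu: "(nu has_real_derivative pnu t) (at t)" for t using nu by (auto simp: newton_def)
  have "((\<lambda>t. sin (nu t)) has_real_derivative cos (nu t) * pnu t) (at t)" for t
    using dnu[of t] by (auto intro!: derivative_eq_intros)
  moreover have sinP: "sin (nu (t + P)) = sin (nu t)" for t
    using min_period_int[OF per, of t 1] by (simp add: cyl_of_def)
  moreover have "P > 0" using per by (simp add: min_period_def)
  ultimately obtain t1 where "cos (nu t1) * pnu t1 = 0"
    using Rolle_periodic[of "\<lambda>t. sin (nu t)" "\<lambda>t. cos (nu t) * pnu t" P] sinP[of 0] by auto
  then have t1: "cos (nu t1) = 0" using p0 by simp
  have two: "cyl_of (nu t, pnu t) = cyl_of (nu t1, pnu t1) \<or>
      cyl_of (nu t, pnu t) = (0, - sin (nu t1), G (- sin (nu t1)))" if t: "cos (nu t) = 0" for t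
  proof -
    have "sin (nu t) = sin (nu t1) \<or> sin (nu t) = - sin (nu t1)"
      using t t1 unfolding cos_eq_0_iff_sin by auto
    then show ?thesis using t t1 by (auto simp: cyl_of_def pG)
  qed
  note cross = nu_half_period_crossings[OF nu per t1 two]
  have half: "cos (nu (t1 + P / 2)) = 0"
  proof -
    have "t1 + of_int 1 * (P / 2) \<in> range (\<lambda>k::int. t1 + of_int k * (P / 2))" by (rule rangeI)
    then show ?thesis using cross(1) by auto
  qed
  have "sin (nu (t1 + P / 2)) \<noteq> sin (nu t1)"
    using cross(2) half t1 by (auto simp: cyl_of_def pG)
  then consider "sin (nu t1) = -1" "sin (nu (t1 + P / 2)) = 1"
    | "sin (nu t1) = 1" "sin (nu (t1 + P / 2)) = -1"
    using half t1 unfolding cos_eq_0_iff_sin by auto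
  then show ?thesis
  proof cases
    case 1
    then show ?thesis using cross(1) by blast
  next
    case 2
    \<comment> \<open>The base time moves by half a period so that the progression begins with
      symbol 1, as \<open>word_L\<close> does.\<close>
    have "t1 + P / 2 + P / 2 = t1 + P" by simp
    then have "sin (nu (t1 + P / 2 + P / 2)) = 1" using 2 sinP[of t1] by (simp only:)
    moreover have "{t. cos (nu t) = 0} = range (\<lambda>k::int. t1 + P / 2 + of_int k * (P / 2))"
      using cross(1) range_progression_shift[of t1 1 "P / 2"] by simp
    ultimately show ?thesis using 2 by blast
  qed
qed

text \<open>If \<open>g\<close> were exactly the maximum of the potential, a maximizer with zero
  momentum would be a critical point on the level.\<close>

lemma nu_level_dichotomy:
  assumes reg: "regular_value (Hnu d m1 m2 h) g"
  shows "(\<exists>s. \<bar>s\<bar> \<le> 1 \<and> d * (m1 - m2) * s + h * d\<^sup>2 * s\<^sup>2 > g) \<or>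
         (\<forall>s. \<bar>s\<bar> \<le> 1 \<longrightarrow> d * (m1 - m2) * s + h * d\<^sup>2 * s\<^sup>2 < g)"
proof (rule ccontr)
  let ?V = "\<lambda>s. d * (m1 - m2) * s + h * d\<^sup>2 * s\<^sup>2"
  assume "\<not> ?thesis"
  then obtain s1 where le: "\<And>s. \<bar>s\<bar> \<le> 1 \<Longrightarrow> ?V s \<le> g" and s1: "\<bar>s1\<bar> \<le> 1" "?V s1 = g"
    by (meson not_less order_antisym)
  define v where "v = arcsin s1"
  have v: "sin v = s1" using s1(1) by (simp add: v_def abs_le_iff)
  have "((\<lambda>v. ?V (sin v)) has_real_derivative
      d * (m1 - m2) * cos v + 2 * h * d\<^sup>2 * sin v * cos v) (at v)"
    by (auto intro!: derivative_eq_intros)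
  then have "d * (m1 - m2) * cos v + 2 * h * d\<^sup>2 * sin v * cos v = 0"
    by (rule DERIV_local_max[of _ _ _ 1]) (use le s1 v in auto)
  moreover have "Hnu d m1 m2 h (v, 0) = g" using s1 v by (simp add: Hnu_def)
  ultimately show False using Hnu_critical[OF reg] by blast
qed

text \<open>The branch of sign \<open>\<eta>\<close> is a connected graph over the whole circle that
  meets the component \<open>C\<close>, hence lies in it.\<close>

lemma winding_component_not_nullhomotopic:
  assumes above: "\<And>s. \<bar>s\<bar> \<le> 1 \<Longrightarrow> d * (m1 - m2) * s + h * d\<^sup>2 * s\<^sup>2 < g"
    and C: "C \<in> components (cyl_of ` {z. Hnu d m1 m2 h z = g})"
    and \<eta>: "\<eta> \<in> {-1, 1}"
    and pt: "cyl_of (v0, \<eta> * sqrt (2 * (g - (d * (m1 - m2) * sin v0 + h * d\<^sup>2 * (sin v0)\<^sup>2)))) \<in> C"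
  shows "\<not> (\<exists>a. homotopic_with_canon (\<lambda>_. True) C cylinder id (\<lambda>_. a))"
proof -
  let ?G = "\<lambda>s. \<eta> * sqrt (2 * (g - (d * (m1 - m2) * s + h * d\<^sup>2 * s\<^sup>2)))"
  let ?g = "\<lambda>(c, s). (c, s, ?G s)" and ?S = "sphere (0 :: real, 0 :: real) 1"
  have cG: "continuous_on UNIV ?G" by (intro continuous_intros)
  have cg: "continuous_on ?S ?g"
    unfolding case_prod_beta
    by (intro continuous_intros)
  have conn: "connected (?g ` ?S)"
    by (rule connected_continuous_image[OF cg]) (simp add: connected_sphere)
  have sub: "?g ` ?S \<subseteq> cyl_of ` {z. Hnu d m1 m2 h z = g}"
  proof clarify
    fix c s :: real assume "(c, s) \<in> ?S"
    then have "c\<^sup>2 + s\<^sup>2 = 1" by (simp add: dist_norm norm_Pair)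
    then obtain v where v: "c = cos v" "s = sin v" using sincos_total_2pi by metis
    have "\<eta>\<^sup>2 = 1" using \<eta> by auto
    then have "(?G s)\<^sup>2 = 2 * (g - (d * (m1 - m2) * s + h * d\<^sup>2 * s\<^sup>2))"
      using above[of s] v by (simp add: power_mult_distrib)
    then have "Hnu d m1 m2 h (v, ?G s) = g" unfolding Hnu_def prod.case v by (simp add: field_simps)
    moreover have "(c, s, ?G s) = cyl_of (v, ?G s)" by (simp add: cyl_of_def v)
    ultimately show "(c, s, ?G s) \<in> cyl_of ` {z. Hnu d m1 m2 h z = g}" by blast
  qed
  have "?g (cos v0, sin v0) \<in> ?g ` ?S"
    by (rule imageI) (simp add: dist_norm norm_Pair)
  then have "C \<inter> ?g ` ?S \<noteq> {}" using pt by (auto simp: cyl_of_def)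
  then have "?g ` ?S \<subseteq> C" by (rule components_maximal[OF C conn sub])
  then show ?thesis by (rule winding_not_nullhomotopic[OF cG])
qed

text \<open>With \<open>s = sin \<nu>\<close> and \<open>c = cosh \<lambda>\<close> this says that on a satellite torus the \<open>\<lambda>\<close>-motion has more
  energy than the barrier at \<open>\<lambda> = 0\<close>.\<close>

lemma satellite_above_barrier:
  fixes A a B g s c :: real
  assumes "B < 0" "\<bar>a\<bar> < A" "\<bar>s\<bar> \<le> 1" "a * s + B * s\<^sup>2 > g"
    and "c \<ge> 1" "- A * c - B * c\<^sup>2 \<le> - g" "- A - B \<noteq> - g"
  shows "- A - B < - g"
proof (rule ccontr)
  assume "\<not> ?thesis"
  then have lt: "- g < - A - B" using assms(7) by simp
  then have "c \<noteq> 1" using assms(6) by auto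
  then have c: "c > 1" using assms(5) by simp
  \<comment> \<open>With a barrier above \<open>- g\<close>, the potential must drop between 1 and
    \<open>c\<close>. This forces \<open>A\<close> to be at least \<open>- 2 * B\<close>.\<close>
  have "(c - 1) * (- B * (c + 1) - A) < 0"
    using lt assms(6) by (simp add: algebra_simps power2_eq_square)
  then have "- B * (c + 1) < A" using c by (simp add: mult_less_0_iff)
  moreover have "- B * 2 \<le> - B * (c + 1)" using assms(1) c by (intro mult_left_mono) auto
  ultimately have A: "- B * 2 \<le> A" by linarith
  have "a * s \<le> A * \<bar>s\<bar>"
    using mult_right_mono[of "\<bar>a\<bar>" A "\<bar>s\<bar>"] assms(2) abs_ge_self[of "a * s"]
    by (simp add: abs_mult)
  \<comment> \<open>For such \<open>A\<close> the function \<open>A * x + B * x\<^sup>2\<close>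
    increases on \<open>[0, 1]\<close>, so \<open>A + B\<close> bounds the
    \<open>nu\<close>-potential at \<open>s\<close>, which exceeds \<open>g\<close>; but
    \<open>A + B < g\<close>.\<close>
  moreover have "(1 - \<bar>s\<bar>) * (A + B * (1 + \<bar>s\<bar>)) \<ge> 0"
  proof (intro mult_nonneg_nonneg)
    have "- B * (1 + \<bar>s\<bar>) \<le> - B * 2" using assms(1,3) by (intro mult_left_mono) auto
    then show "0 \<le> A + B * (1 + \<bar>s\<bar>)" using A by linarith
  qed (use assms(3) in simp)
  moreover have "(1 - \<bar>s\<bar>) * (A + B * (1 + \<bar>s\<bar>)) = A + B - A * \<bar>s\<bar> - B * s\<^sup>2"
  proof -
    have "s\<^sup>2 = \<bar>s\<bar> * \<bar>s\<bar>" by (simp add: power2_eq_square)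
    then show ?thesis by (simp add: algebra_simps)
  qed
  ultimately show False using lt assms(4) by linarith
qed

section \<open>Syzygy sequences\<close>

theorem theorem1:
  fixes d m1 m2 h g Tl Tn T :: real
    and lam plam nu pnu :: "real \<Rightarrow> real"
    and Cl :: "(real \<times> real) set"
    and Cn :: "(real \<times> real \<times> real) set"
    and p q :: nat
  assumes d: "d > 0" and m1: "m1 > 0" and m2: "m2 > 0" and h: "h < 0"
    \<comment> \<open>regular torus T = Cl x Cn in the set {H_lambda = -g, H_nu = g}\<close>
    and reg_l: "regular_value (Hlam d m1 m2 h) (- g)"
    and reg_n: "regular_value (Hnu d m1 m2 h) g"
    and Cl_comp: "Cl \<in> components {z. Hlam d m1 m2 h z = - g}" and Cl_cpt: "compact Cl"
    and Cn_comp: "Cn \<in> components (cyl_of ` {z. Hnu d m1 m2 h z = g})" and Cn_cpt: "compact Cn"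
    \<comment> \<open>gamma: a solution of the regularized flow on the zero level, lying on the torus\<close>
    and sol: "reg_solution d m1 m2 h lam plam nu pnu"
    and zero: "Hlam d m1 m2 h (lam 0, plam 0) + Hnu d m1 m2 h (nu 0, pnu 0) = 0"
    and on_l: "\<forall>t. (lam t, plam t) \<in> Cl"
    and on_n: "\<forall>t. cyl_of (nu t, pnu t) \<in> Cn"
    \<comment> \<open>no collision points\<close>
    and nocoll: "\<forall>t. \<not> (lam t = 0 \<and> cos (nu t) = 0)"
    \<comment> \<open>gamma is periodic with (minimal) period T in the regularized phase space\<close>
    and per: "min_period (\<lambda>t. (lam t, plam t, cyl_of (nu t, pnu t))) T"
    \<comment> \<open>periods of the two one-degree-of-freedom motions, rotation number W = Tn/Tl = p/q\<close>
    and perl: "min_period (\<lambda>t. (lam t, plam t)) Tl"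
    and pern: "min_period (\<lambda>t. cyl_of (nu t, pnu t)) Tn"
    and pq: "p > 0" "q > 0" "coprime p q"
    and W: "Tn / Tl = real p / real q"
  shows "finite (syzygy_times lam nu T) \<and>
    \<comment> \<open>type S: Cn contractible in the cylinder\<close>
    ((\<exists>a. homotopic_with_canon (\<lambda>_. True) Cn cylinder id (\<lambda>_. a)) \<longrightarrow>
       (\<exists>c y0 s k. c \<in> {1, 2} \<and> line_avoids_lattice (Tn / Tl) y0 \<and>
          syzygy_word lam nu T = rotate k (word_S c (sturm (Tn / Tl) y0) s))
       \<and> length (syzygy_word lam nu T) = 2 * (p + q)) \<and>
    \<comment> \<open>type L: Cn winds around the cylinder and Cl meets lambda = 0\<close>
    ((\<not> (\<exists>a. homotopic_with_canon (\<lambda>_. True) Cn cylinder id (\<lambda>_. a)) \<and> (\<exists>z\<in>Cl. fst z = 0)) \<longrightarrow>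
       (\<exists>y0 s k. line_avoids_lattice (Tn / Tl) y0 \<and>
          syzygy_word lam nu T = rotate k (word_L (sturm (Tn / Tl) y0) s))
       \<and> length (syzygy_word lam nu T) = 2 * (p + q)) \<and>
    \<comment> \<open>type P: Cn winds around the cylinder and Cl does not meet lambda = 0\<close>
    ((\<not> (\<exists>a. homotopic_with_canon (\<lambda>_. True) Cn cylinder id (\<lambda>_. a)) \<and> \<not> (\<exists>z\<in>Cl. fst z = 0)) \<longrightarrow>
       (\<exists>k. syzygy_word lam nu T = rotate k (word_P q)))"
proof -
  define A a B where "A = d * (m1 + m2)" and "a = d * (m1 - m2)" and "B = h * d\<^sup>2"
  have B: "B < 0" using d h by (simp add: B_def mult_neg_pos)
  have aA: "\<bar>a\<bar> < A"
    using d m1 m2 unfolding A_def a_def by (simp add: abs_mult)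
  have lam: "newton (lam_force A B) lam plam" and nu: "newton (nu_force a B) nu pnu"
    using sol unfolding reg_solution_def newton_def lam_force_def nu_force_def A_def a_def B_def
    by (simp_all add: mult.assoc)
  have Hl: "Hlam d m1 m2 h z = - g" if "z \<in> Cl" for z
    using that in_components_subset[OF Cl_comp] by auto
  have energy_l: "(plam t)\<^sup>2 / 2 - A * cosh (lam t) - B * (cosh (lam t))\<^sup>2 = - g" for t
    using Hl[OF on_l[rule_format, of t]] by (simp add: Hlam_def A_def B_def)
  have Hn: "p\<^sup>2 / 2 + a * s + B * s\<^sup>2 = g" if "(c, s, p) \<in> Cn" for c s p
    using that in_components_subset[OF Cn_comp] by (auto simp: cyl_of_def Hnu_def a_def B_def)
  have energy_n: "(pnu t)\<^sup>2 / 2 + a * sin (nu t) + B * (sin (nu t))\<^sup>2 = g" for t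
    using on_n[rule_format, of t] Hn by (simp add: cyl_of_def)
  have "min_period (\<lambda>t. ((lam t, plam t), cyl_of (nu t, pnu t))) T"
    using per unfolding min_period_def prod.inject conj_assoc .
  note T = min_period_Pair[OF this perl pern pq W]
  have Tl: "Tl > 0" and Tn: "Tn > 0" using perl pern by (auto simp: min_period_def)
  have lamT: "lam (t + T) = lam t" and sinT: "sin (nu (t + T)) = sin (nu t)" for t
    using min_period_int[OF per, of t 1] by (simp_all add: cyl_of_def)
  have sin_per: "sin (nu (t + of_int k * Tn)) = sin (nu t)" for t k
    using min_period_int[OF pern, of t k] by (simp add: cyl_of_def)
  have nocoll': "\<not> (lam t = 0 \<and> cos (nu t) = 0)" for t using nocoll by blast
  have barrier: "- A - B \<noteq> - g"
    using Hlam_critical[OF reg_l] by (simp add: Hlam_def A_def B_def)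
  have T_half: "T = real (2 * q) * (Tn / 2)" "T = real (2 * p) * (Tl / 2)"
    using T by simp_all
  have ratio: "(Tn / 2) / (Tl / 2) = Tn / Tl" by simp
  have Tn_le: "Tn \<le> T" using T(1) Tn pq(2) mult_right_mono[of 1 "real q" Tn] by simp
  note sturmian = syzygy_word_sturm[OF half_gt_zero[OF Tn] half_gt_zero[OF Tl] T_half,
      where lam = lam and nu = nu, OF _ _ _ _ nocoll' lamT sinT, unfolded ratio]
  \<comment> \<open>Shifting by whole periods \<open>Tn\<close>, that is by even numbers of half
    steps, brings the base crossing into one period without changing its symbol.\<close>
  have normalize: "\<exists>t0'.
      range (\<lambda>k::int. t0 + of_int k * (Tn / 2)) = range (\<lambda>k::int. t0' + of_int k * (Tn / 2))
      \<and> 0 \<le> t0' \<and> t0' < T \<and> (\<forall>r. sin (nu (t0' + r)) = sin (nu (t0 + r)))" for t0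
  proof (intro exI conjI)
    let ?j = "- \<lfloor>t0 / Tn\<rfloor>"
    show "range (\<lambda>k::int. t0 + of_int k * (Tn / 2)) =
        range (\<lambda>k::int. (t0 + of_int ?j * Tn) + of_int k * (Tn / 2))"
      using range_progression_shift[of t0 "2 * ?j" "Tn / 2"] by simp
    show "0 \<le> t0 + of_int ?j * Tn" using floor_divide_lower[OF Tn, of t0] by simp
    show "t0 + of_int ?j * Tn < T"
      using floor_divide_upper[OF Tn, of t0] Tn_le by (simp add: distrib_right)
    show "\<forall>r. sin (nu (t0 + of_int ?j * Tn + r)) = sin (nu (t0 + r))"
    proof
      fix r
      have "t0 + of_int ?j * Tn + r = (t0 + r) + of_int ?j * Tn" by (simp only: add_ac)
      then show "sin (nu (t0 + of_int ?j * Tn + r)) = sin (nu (t0 + r))" using sin_per by metis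
    qed
  qed
  \<comment> \<open>Comparing \<open>g\<close> with the maximum of the potential settles whether
    \<open>Cn\<close> is contractible, so in each case the implications for the opposite kind are
    vacuous.\<close>
  show ?thesis
  proof (cases "\<exists>s. \<bar>s\<bar> \<le> 1 \<and> a * s + B * s\<^sup>2 > g")
    case True
    then obtain s0 where s0: "\<bar>s0\<bar> \<le> 1" "a * s0 + B * s0\<^sup>2 > g" by blast
    have "Cn \<subseteq> cylinder"
      using in_components_subset[OF Cn_comp] by (auto simp: cylinder_def)
    moreover have "s \<noteq> s0" if "(c, s, r) \<in> Cn" for c s r
      using Hn[OF that] s0(2) zero_le_power2[of r] by auto
    ultimately have null: "\<exists>a. homotopic_with_canon (\<lambda>_. True) Cn cylinder id (\<lambda>_. a)"
      using cylinder_minus_line_nullhomotopic s0(1) by blast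
    \<comment> \<open>The point \<open>cosh (lam 0)\<close> is accessible at energy
      \<open>- g\<close>. Hence a contractible \<open>Cn\<close> always comes with motion across
      \<open>lam = 0\<close>.\<close>
    have "- A * cosh (lam 0) - B * (cosh (lam 0))\<^sup>2 \<le> - g"
      using energy_l[of 0] zero_le_power2[of "plam 0"] by linarith
    then have "- A - B < - g"
      using satellite_above_barrier[OF B aA s0 cosh_real_ge_1] barrier by blast
    then obtain b where b: "{t. lam t = 0} = range (\<lambda>k::int. b + of_int k * (Tl / 2))"
      using lam_zeros[OF lam perl energy_l B] by blast
    obtain t1 \<sigma> where t1: "{t. cos (nu t) = 0} = range (\<lambda>k::int. t1 + of_int k * (Tn / 2))"
      and \<sigma>: "\<sigma> \<in> {-1, 1}" "\<And>t. cos (nu t) = 0 \<Longrightarrow> sin (nu t) = \<sigma>"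
      using nu_crossings_satellite[OF nu pern energy_n B s0] by blast
    obtain t0 where t0: "{t. cos (nu t) = 0} = range (\<lambda>k::int. t0 + of_int k * (Tn / 2))"
      "0 \<le> t0" "t0 < T"
      using normalize[of t1] unfolding t1 by blast
    define c :: nat where "c = (if \<sigma> = -1 then 1 else 2)"
    have sym: "syzygy_symbol lam nu (t0 + (real i - 1) * (Tn / 2)) = c" for i
    proof -
      have "t0 + of_int (int i - 1) * (Tn / 2) \<in> {t. cos (nu t) = 0}"
        unfolding t0(1) by (rule rangeI)
      then have "cos (nu (t0 + (real i - 1) * (Tn / 2))) = 0" by simp
      then show ?thesis
        using \<sigma>(2) nocoll' by (auto simp: syzygy_symbol_def c_def)
    qed
    note word = sturmian[OF t0(1) b t0(2,3), of "\<lambda>_. c", OF sym]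
    have "c \<in> {1, 2}" by (simp add: c_def)
    then have "\<exists>c y0 s k. c \<in> {1, 2} \<and> line_avoids_lattice (Tn / Tl) y0 \<and>
        syzygy_word lam nu T = rotate k (word_S c (sturm (Tn / Tl) y0) s)"
      using word(3) unfolding word_S_def by blast
    then show ?thesis using word(1,2) null by blast
  next
    case False
    then have above: "a * s + B * s\<^sup>2 < g" if "\<bar>s\<bar> \<le> 1" for s
      using nu_level_dichotomy[OF reg_n] that unfolding a_def B_def by blast
    have "continuous_on UNIV pnu"
      using nu unfolding newton_def by (meson DERIV_isCont continuous_at_imp_continuous_on)
    from momentum_of_sin[OF this energy_n above]
    obtain \<eta> where \<eta>: "\<eta> \<in> {-1, 1}"
      and pG: "\<And>t. pnu t = \<eta> * sqrt (2 * (g - (a * sin (nu t) + B * (sin (nu t))\<^sup>2)))" by blast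
    have "cyl_of (nu 0, \<eta> * sqrt (2 * (g - (a * sin (nu 0) + B * (sin (nu 0))\<^sup>2)))) \<in> Cn"
      using on_n pG by metis
    then have nonnull: "\<not> (\<exists>a. homotopic_with_canon (\<lambda>_. True) Cn cylinder id (\<lambda>_. a))"
      using winding_component_not_nullhomotopic[OF _ Cn_comp \<eta>] above unfolding a_def B_def by blast
    have "pnu t \<noteq> 0" for t using energy_n[of t] above[of "sin (nu t)"] by auto
    then obtain t1 where t1: "{t. cos (nu t) = 0} = range (\<lambda>k::int. t1 + of_int k * (Tn / 2))"
      "sin (nu t1) = -1" "sin (nu (t1 + Tn / 2)) = 1"
      using nu_crossings_winding[OF nu pern pG] by blast
    obtain t0 where t0: "{t. cos (nu t) = 0} = range (\<lambda>k::int. t0 + of_int k * (Tn / 2))"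
      "0 \<le> t0" "t0 < T" and shift: "\<And>r. sin (nu (t0 + r)) = sin (nu (t1 + r))"
      using normalize[of t1] unfolding t1(1) by blast
    have sin0: "sin (nu t0) = -1" "sin (nu (t0 + Tn / 2)) = 1"
      using shift[of 0] shift[of "Tn / 2"] t1(2,3) by simp_all
    \<comment> \<open>The base crossing has \<open>sin nu = -1\<close>, so odd blocks open with 1
      and even ones with 2.\<close>
    define c :: "nat \<Rightarrow> nat" where "c = (\<lambda>i. if odd i then 1 else 2)"
    have sym: "syzygy_symbol lam nu (t0 + (real i - 1) * (Tn / 2)) = c i" for i
    proof -
      have "t0 + of_int (int i - 1) * (Tn / 2) \<in> {t. cos (nu t) = 0}"
        unfolding t0(1) by (rule rangeI)
      then have "lam (t0 + (real i - 1) * (Tn / 2)) \<noteq> 0"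
        using nocoll'[of "t0 + (real i - 1) * (Tn / 2)"] by simp
      moreover have "sin (nu (t0 + (real i - 1) * (Tn / 2))) = (if odd i then -1 else 1)"
      proof (cases "odd i")
        case True
        then obtain j where "i = 2 * j + 1" by (blast elim: oddE)
        then have "t0 + (real i - 1) * (Tn / 2) = t0 + of_int (int j) * Tn" by simp
        then have "sin (nu (t0 + (real i - 1) * (Tn / 2))) = -1"
          using sin_per[of t0 "int j"] sin0(1) by (simp only:)
        then show ?thesis using True by simp
      next
        case False
        then obtain j where "i = 2 * j" by (blast elim: evenE)
        then have "t0 + (real i - 1) * (Tn / 2) = (t0 + Tn / 2) + of_int (int j - 1) * Tn"
          by (simp add: field_simps)
        then have "sin (nu (t0 + (real i - 1) * (Tn / 2))) = 1"
          using sin_per[of "t0 + Tn / 2" "int j - 1"] sin0(2) by (simp only:)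
        then show ?thesis using False by simp
      qed
      ultimately show ?thesis by (simp add: syzygy_symbol_def c_def)
    qed
    show ?thesis
    proof (cases "\<exists>z\<in>Cl. fst z = 0")
      case True
      then obtain r where "(0, r) \<in> Cl" by auto
      \<comment> \<open>At \<open>lam = 0\<close> the energy is \<open>r\<^sup>2 / 2\<close> above
        the barrier, and equality with the barrier is excluded by regularity.\<close>
      then have "r\<^sup>2 / 2 - A - B = - g" using Hl by (force simp: Hlam_def A_def B_def)
      then have "- A - B < - g" using barrier zero_le_power2[of r] by linarith
      then obtain b where b: "{t. lam t = 0} = range (\<lambda>k::int. b + of_int k * (Tl / 2))"
        using lam_zeros[OF lam perl energy_l B] by blast
      note word = sturmian[OF t0(1) b t0(2,3), of c, OF sym]
      have "\<exists>y0 s k. line_avoids_lattice (Tn / Tl) y0 \<and>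
          syzygy_word lam nu T = rotate k (word_L (sturm (Tn / Tl) y0) s)"
        using word(3) unfolding word_L_def c_def by blast
      then show ?thesis using word(1,2) nonnull True by blast
    next
      case False
      then have ne: "{t. lam t = 0} = {}" using on_l by force
      then have fin: "finite ({t. lam t = 0} \<inter> {u..<v})" for u v by simp
      \<comment> \<open>Without zeros of \<open>lam\<close> all \<open>2 * q\<close> blocks are bare
        letters.\<close>
      note word = syzygy_word_blocks[OF half_gt_zero[OF Tn] T_half(1) t0 fin nocoll' lamT sinT sym]
      have "\<exists>k. syzygy_word lam nu T = rotate k (word_P q)"
        using word(2) unfolding word_P_alternating word_L_def c_def ne by simp
      then show ?thesis using word(1) nonnull False by blast
    qed
  qed
qed

end
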